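(* Let $m\ge2$, let $H$ be a complex Hilbert space, let $E$ be a POVM on $\Omega_m=\{0,\dots,m-1\}^{\mathbb N}$ with values in $B(H)$, and let $(K_E,P,V)$ be the range space dilation of $E$, with canonical isometries $U_n:K_n\to K_E$. Self-adjoint operators $T\in B(K_E)$ satisfying $$TP(B)=P(B)T,\qquad B\in\mathcal B(\Omega_m),$$ are in one-to-one correspondence with bounded range martingales $\{X_w\}$ for $E$. The correspondence is given by $$U_n^*TU_n=\bigoplus_{|w|=n}X_w,\qquad n\ge0.$$
   Context: $\Omega_m$ carries its product Borel $\sigma$-algebra $\mathcal B(\Omega_m)$. For a finite word $w=w_1\cdots w_n$ in $\{0,\dots,m-1\}$, $|w|=n$ and $[w]=\{x\in\Omega_m:x_1=w_1,\dots,x_n=w_n\}$; the empty word is $\varnothing$, and $[\varnothing]=\Omega_m$; $wj$ is $w$ with the letter $j$ appended. A POVM on $\Omega_m$ with values in $B(H)$ is a map $E:\mathcal B(\Omega_m)\to B(H)_+$ that is countably additive in the weak operator topology and satisfies $E(\Omega_m)=I$; it is a projection-valued measure (PVM) if all its values are orthogonal projections. Put $E_w=E([w])$ and $H_w=\overline{\operatorname{ran}}(E_w^{1/2})$. For $0\le j\le m-1$, the edge contraction $C_{wj}:H_w\to H_{wj}$ is the unique contraction with $C_{wj}E_w^{1/2}h=E_{wj}^{1/2}h$ for all $h\in H$. Range space dilation: set $K_n=\bigoplus_{|w|=n}H_w$ (so $K_0=H$), and let $J_n:K_n\to K_{n+1}$ be the isometry $(J_nx)_{wj}=C_{wj}x_w$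 for $|w|=n$, $0\le j\le m-1$. $K_E$ is the Hilbert space direct limit of $K_0\xrightarrow{J_0}K_1\xrightarrow{J_1}K_2\to\cdots$, with canonical isometries $U_n:K_n\to K_E$ satisfying $U_{n+1}J_n=U_n$ and $K_E=\overline{\bigcup_{n\ge0}U_nK_n}$; $V=U_0$. For $n\ge|w|$, $P_w^{(n)}$ is the orthogonal projection of $K_n$ onto $\bigoplus_{|u|=n,\,u\succeq w}H_u$, where $u\succeq w$ means $u$ extends $w$. $P$ is the unique PVM on $\Omega_m$ with values in $B(K_E)$ such that $P([w])U_n=U_nP_w^{(n)}$ for every finite word $w$ and every $n\ge|w|$. A bounded range martingale for $E$ is a family of self-adjoint operators $X_w\in B(H_w)$, indexed by all finite words $w$, such that $\sup_w\|X_w\|<\infty$ and $X_w=\sum_{j=0}^{m-1}C_{wj}^*X_{wj}C_{wj}$ for every finite word $w$. *)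

theory Defs
  imports "HOL-Analysis.Analysis" "HOL-Library.Sublist"
begin

section \<open>Complex Hilbert spaces\<close>

text \<open>The inner product is linear in its first argument.  Positive definiteness is contained in
  \<open>cinner_self\<close>, completeness in the superclass \<^class>\<open>banach\<close>.\<close>

class chilbert_space = banach +
  fixes scaleC :: "complex \<Rightarrow> 'a \<Rightarrow> 'a" (infixr "*\<^sub>C" 75)
    and cinner :: "'a \<Rightarrow> 'a \<Rightarrow> complex"
  assumes scaleC_add_right: "c *\<^sub>C (x + y) = c *\<^sub>C x + c *\<^sub>C y"
    and scaleC_add_left: "(c + d) *\<^sub>C x = c *\<^sub>C x + d *\<^sub>C x"
    and scaleC_scaleC: "c *\<^sub>C (d *\<^sub>C x) = (c * d) *\<^sub>C x"
    and scaleR_scaleC: "r *\<^sub>R x = complex_of_real r *\<^sub>C x"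
    and cinner_commute: "cinner x y = cnj (cinner y x)"
    and cinner_add_left: "cinner (x + y) z = cinner x z + cinner y z"
    and cinner_scaleC_left: "cinner (c *\<^sub>C x) y = c * cinner x y"
    and cinner_self: "cinner x x = complex_of_real ((norm x)\<^sup>2)"

instantiation complex :: chilbert_space
begin

definition scaleC_complex :: "complex \<Rightarrow> complex \<Rightarrow> complex"
  where "scaleC_complex c x = c * x"

definition cinner_complex :: "complex \<Rightarrow> complex \<Rightarrow> complex"
  where "cinner_complex x y = x * cnj y"

instance
  by standard
    (simp_all add: scaleC_complex_def cinner_complex_def algebra_simps scaleR_conv_of_real
      complex_norm_square[symmetric])

end

section \<open>Operators between closed subspaces\<close>

text \<open>Elements of \<open>bounded_ops M N\<close> are \<open>undefined\<close> outside \<open>M\<close>, so that equality of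
  functions is equality of operators.\<close>

definition bounded_ops :: "'a::chilbert_space set \<Rightarrow> 'b::chilbert_space set \<Rightarrow> ('a \<Rightarrow> 'b) set"
  where "bounded_ops M N = {A \<in> M \<rightarrow>\<^sub>E N.
    (\<forall>x\<in>M. \<forall>y\<in>M. A (x + y) = A x + A y) \<and>
    (\<forall>c. \<forall>x\<in>M. A (c *\<^sub>C x) = c *\<^sub>C A x) \<and>
    (\<exists>K. \<forall>x\<in>M. norm (A x) \<le> K * norm x)}"

definition onorm_on :: "'a::chilbert_space set \<Rightarrow> ('a \<Rightarrow> 'b::chilbert_space) \<Rightarrow> real"
  where "onorm_on M A = (SUP x\<in>M. norm (A x) / norm x)"

definition selfadjoint_on :: "'a::chilbert_space set \<Rightarrow> ('a \<Rightarrow> 'a) \<Rightarrow> bool"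
  where "selfadjoint_on M A \<longleftrightarrow> A \<in> bounded_ops M M \<and>
    (\<forall>x\<in>M. \<forall>y\<in>M. cinner (A x) y = cinner x (A y))"

text \<open>The adjoint of an operator \<open>A\<close> with domain \<open>M\<close>; the inner products \<open>ip\<close> of the domain and
  \<open>ip'\<close> of the codomain are arguments because the finite direct sums below are not types.\<close>

definition adj_on ::
    "'a set \<Rightarrow> ('a \<Rightarrow> 'a \<Rightarrow> complex) \<Rightarrow> ('b \<Rightarrow> 'b \<Rightarrow> complex) \<Rightarrow> ('a \<Rightarrow> 'b) \<Rightarrow> 'b \<Rightarrow> 'a"
  where "adj_on M ip ip' A y = (THE x. x \<in> M \<and> (\<forall>z\<in>M. ip' (A z) y = ip z x))"

definition positive_op :: "('a::chilbert_space \<Rightarrow> 'a) \<Rightarrow> bool"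
  where "positive_op A \<longleftrightarrow> selfadjoint_on UNIV A \<and> (\<forall>x. 0 \<le> Re (cinner (A x) x))"

definition sqrt_op :: "('a::chilbert_space \<Rightarrow> 'a) \<Rightarrow> 'a \<Rightarrow> 'a"
  where "sqrt_op A = (THE S. positive_op S \<and> S \<circ> S = A)"

definition orth_projection :: "('a::chilbert_space \<Rightarrow> 'a) \<Rightarrow> bool"
  where "orth_projection A \<longleftrightarrow> selfadjoint_on UNIV A \<and> A \<circ> A = A"

section \<open>Measures on the sequence space\<close>

text \<open>The space of sequences over \<open>{0, \<dots>, m - 1}\<close> with its product sigma-algebra; sequences are
  indexed from \<open>0\<close>.\<close>

definition Omega :: "nat \<Rightarrow> (nat \<Rightarrow> nat) measure"
  where "Omega m = PiM UNIV (\<lambda>_. count_space {..<m})"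

definition words :: "nat \<Rightarrow> nat list set"
  where "words m = lists {..<m}"

definition nwords :: "nat \<Rightarrow> nat \<Rightarrow> nat list set"
  where "nwords m n = {w \<in> words m. length w = n}"

definition cyl :: "nat \<Rightarrow> nat list \<Rightarrow> (nat \<Rightarrow> nat) set"
  where "cyl m w = {x \<in> space (Omega m). \<forall>i<length w. x i = w ! i}"

definition povm :: "nat \<Rightarrow> ((nat \<Rightarrow> nat) set \<Rightarrow> 'a::chilbert_space \<Rightarrow> 'a) \<Rightarrow> bool"
  where "povm m E \<longleftrightarrow>
    (\<forall>B\<in>sets (Omega m). positive_op (E B)) \<and>
    (\<forall>A. range A \<subseteq> sets (Omega m) \<and> disjoint_family A \<longrightarrow>
      (\<forall>x y. (\<lambda>i::nat. cinner (E (A i) x) y) sums cinner (E (\<Union>i. A i) x) y)) \<and>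
    E (space (Omega m)) = id"

definition pvm :: "nat \<Rightarrow> ((nat \<Rightarrow> nat) set \<Rightarrow> 'a::chilbert_space \<Rightarrow> 'a) \<Rightarrow> bool"
  where "pvm m E \<longleftrightarrow> povm m E \<and> (\<forall>B\<in>sets (Omega m). orth_projection (E B))"

section \<open>The range space dilation\<close>

definition rsqrt :: "nat \<Rightarrow> ((nat \<Rightarrow> nat) set \<Rightarrow> 'h::chilbert_space \<Rightarrow> 'h) \<Rightarrow> nat list \<Rightarrow> 'h \<Rightarrow> 'h"
  where "rsqrt m E w = sqrt_op (E (cyl m w))"

definition rspace :: "nat \<Rightarrow> ((nat \<Rightarrow> nat) set \<Rightarrow> 'h::chilbert_space \<Rightarrow> 'h) \<Rightarrow> nat list \<Rightarrow> 'h set"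
  where "rspace m E w = closure (range (rsqrt m E w))"

definition edge ::
    "nat \<Rightarrow> ((nat \<Rightarrow> nat) set \<Rightarrow> 'h::chilbert_space \<Rightarrow> 'h) \<Rightarrow> nat list \<Rightarrow> nat \<Rightarrow> 'h \<Rightarrow> 'h"
  where "edge m E w j = (THE C. C \<in> bounded_ops (rspace m E w) (rspace m E (w @ [j])) \<and>
    (\<forall>x\<in>rspace m E w. norm (C x) \<le> norm x) \<and>
    (\<forall>h. C (rsqrt m E w h) = rsqrt m E (w @ [j]) h))"

definition edge_adj ::
    "nat \<Rightarrow> ((nat \<Rightarrow> nat) set \<Rightarrow> 'h::chilbert_space \<Rightarrow> 'h) \<Rightarrow> nat list \<Rightarrow> nat \<Rightarrow> 'h \<Rightarrow> 'h"
  where "edge_adj m E w j = adj_on (rspace m E w) cinner cinner (edge m E w j)"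

text \<open>A vector of the direct sum of the range spaces of the words of length \<open>n\<close> is a family indexed
  by all lists which vanishes off those words.\<close>

definition Kspace ::
    "nat \<Rightarrow> ((nat \<Rightarrow> nat) set \<Rightarrow> 'h::chilbert_space \<Rightarrow> 'h) \<Rightarrow> nat \<Rightarrow> (nat list \<Rightarrow> 'h) set"
  where "Kspace m E n =
    {x. (\<forall>w\<in>nwords m n. x w \<in> rspace m E w) \<and> (\<forall>w. w \<notin> nwords m n \<longrightarrow> x w = 0)}"

definition Kinner ::
    "nat \<Rightarrow> nat \<Rightarrow> (nat list \<Rightarrow> 'h::chilbert_space) \<Rightarrow> (nat list \<Rightarrow> 'h) \<Rightarrow> complex"
  where "Kinner m n x y = (\<Sum>w\<in>nwords m n. cinner (x w) (y w))"

definition Jmap ::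
    "nat \<Rightarrow> ((nat \<Rightarrow> nat) set \<Rightarrow> 'h::chilbert_space \<Rightarrow> 'h) \<Rightarrow> nat \<Rightarrow> (nat list \<Rightarrow> 'h) \<Rightarrow> nat list \<Rightarrow> 'h"
  where "Jmap m E n x v =
    (if v \<in> nwords m (Suc n) then edge m E (butlast v) (last v) (x (butlast v)) else 0)"

text \<open>The orthogonal projection of \<open>Kspace m E n\<close> onto the summands whose word extends \<open>w\<close>.\<close>

definition Kproj :: "nat list \<Rightarrow> (nat list \<Rightarrow> 'h::chilbert_space) \<Rightarrow> nat list \<Rightarrow> 'h"
  where "Kproj w x u = (if prefix w u then x u else 0)"

definition Kdiag ::
    "nat \<Rightarrow> nat \<Rightarrow> (nat list \<Rightarrow> 'h::chilbert_space \<Rightarrow> 'h) \<Rightarrow> (nat list \<Rightarrow> 'h) \<Rightarrow> nat list \<Rightarrow> 'h"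
  where "Kdiag m n X x w = (if w \<in> nwords m n then X w (x w) else 0)"

definition Kisometry ::
    "nat \<Rightarrow> ((nat \<Rightarrow> nat) set \<Rightarrow> 'h::chilbert_space \<Rightarrow> 'h) \<Rightarrow> nat \<Rightarrow>
      ((nat list \<Rightarrow> 'h) \<Rightarrow> 'k::chilbert_space) \<Rightarrow> bool"
  where "Kisometry m E n U \<longleftrightarrow>
    (\<forall>x\<in>Kspace m E n. \<forall>y\<in>Kspace m E n. U (\<lambda>w. x w + y w) = U x + U y) \<and>
    (\<forall>c. \<forall>x\<in>Kspace m E n. U (\<lambda>w. c *\<^sub>C x w) = c *\<^sub>C U x) \<and>
    (\<forall>x\<in>Kspace m E n. norm (U x) = L2_set (\<lambda>w. norm (x w)) (nwords m n))"

text \<open>The type \<open>'k\<close> with the maps \<open>U n\<close> is a direct limit of the spaces \<open>Kspace m E n\<close> along the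
  maps \<open>Jmap m E n\<close>.  The values of \<open>U n\<close> outside \<open>Kspace m E n\<close> are irrelevant.\<close>

definition direct_limit ::
    "nat \<Rightarrow> ((nat \<Rightarrow> nat) set \<Rightarrow> 'h::chilbert_space \<Rightarrow> 'h) \<Rightarrow>
      (nat \<Rightarrow> (nat list \<Rightarrow> 'h) \<Rightarrow> 'k::chilbert_space) \<Rightarrow> bool"
  where "direct_limit m E U \<longleftrightarrow>
    (\<forall>n. Kisometry m E n (U n)) \<and>
    (\<forall>n. \<forall>x\<in>Kspace m E n. U (Suc n) (Jmap m E n x) = U n x) \<and>
    closure (\<Union>n. U n ` Kspace m E n) = UNIV"

text \<open>In the last clause a vector \<open>h\<close> is identified with the family with the single entry \<open>h\<close> at the
  empty word.\<close>

definition range_space_dilation ::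
    "nat \<Rightarrow> ((nat \<Rightarrow> nat) set \<Rightarrow> 'h::chilbert_space \<Rightarrow> 'h) \<Rightarrow>
      (nat \<Rightarrow> (nat list \<Rightarrow> 'h) \<Rightarrow> 'k::chilbert_space) \<Rightarrow>
      ((nat \<Rightarrow> nat) set \<Rightarrow> 'k \<Rightarrow> 'k) \<Rightarrow> ('h \<Rightarrow> 'k) \<Rightarrow> bool"
  where "range_space_dilation m E U P V \<longleftrightarrow>
    direct_limit m E U \<and> pvm m P \<and>
    (\<forall>w\<in>words m. \<forall>n\<ge>length w. \<forall>x\<in>Kspace m E n. P (cyl m w) (U n x) = U n (Kproj w x)) \<and>
    V = (\<lambda>h. U 0 (\<lambda>w. if w = [] then h else 0))"

definition U_adj ::
    "nat \<Rightarrow> ((nat \<Rightarrow> nat) set \<Rightarrow> 'h::chilbert_space \<Rightarrow> 'h) \<Rightarrow>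
      (nat \<Rightarrow> (nat list \<Rightarrow> 'h) \<Rightarrow> 'k::chilbert_space) \<Rightarrow> nat \<Rightarrow> 'k \<Rightarrow> nat list \<Rightarrow> 'h"
  where "U_adj m E U n = adj_on (Kspace m E n) (Kinner m n) cinner (U n)"

section \<open>Bounded range martingales\<close>

text \<open>The family is \<open>undefined\<close> at lists which are not words.\<close>

definition bounded_range_martingale ::
    "nat \<Rightarrow> ((nat \<Rightarrow> nat) set \<Rightarrow> 'h::chilbert_space \<Rightarrow> 'h) \<Rightarrow> (nat list \<Rightarrow> 'h \<Rightarrow> 'h) \<Rightarrow> bool"
  where "bounded_range_martingale m E X \<longleftrightarrow>
    X \<in> extensional (words m) \<and>
    (\<forall>w\<in>words m. selfadjoint_on (rspace m E w) (X w)) \<and>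
    bdd_above ((\<lambda>w. onorm_on (rspace m E w) (X w)) ` words m) \<and>
    (\<forall>w\<in>words m. \<forall>x\<in>rspace m E w.
      X w x = (\<Sum>j<m. edge_adj m E w j (X (w @ [j]) (edge m E w j x))))"

definition commutant_sa ::
    "nat \<Rightarrow> ((nat \<Rightarrow> nat) set \<Rightarrow> 'k::chilbert_space \<Rightarrow> 'k) \<Rightarrow> ('k \<Rightarrow> 'k) set"
  where "commutant_sa m P =
    {T. selfadjoint_on UNIV T \<and> (\<forall>B\<in>sets (Omega m). T \<circ> P B = P B \<circ> T)}"

end

theory Submission
  imports Defs
begin

text \<open>Each summand \<open>rspace m E w\<close> of \<open>Kspace m E n\<close>, \<open>n = length w\<close>, embeds isometrically into the
  dilation space by a map \<open>emb w\<close>, with adjoint \<open>coemb w\<close>.  Embeddings of different words of equal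
  length have orthogonal ranges, \<open>emb w\<close> is the sum of \<open>emb (w @ [j]) \<circ> edge m E w j\<close> over the letters
  \<open>j\<close> (lemma \<open>emb_eq_sum_edge\<close>), and the finite sums of embedded vectors are dense.  In these terms the
  family attached to a self-adjoint operator \<open>T\<close> commuting with \<open>P\<close> is
  \<open>X w = coemb w \<circ> T \<circ> emb w\<close> (\<open>compress T\<close>).

  The projection \<open>P (cyl m w)\<close> fixes the range of \<open>emb w\<close> and annihilates the range of \<open>emb v\<close> for the
  other words \<open>v\<close> of the same length.  An operator \<open>T\<close> commuting with \<open>P\<close> therefore has no off-diagonal
  entries between words of equal length (\<open>commutant_offdiag\<close>).  Hence \<open>U\<^sub>n\<^sup>* T U\<^sub>n\<close> is block diagonal with
  blocks \<open>X w\<close>, and the martingale identity follows by expanding \<open>emb w\<close> over the letters on both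
  sides of \<open>T\<close> and dropping the off-diagonal terms (\<open>compress_martingale\<close>).  Since the blocks
  determine the form \<open>\<langle>T a, b\<rangle>\<close> on a dense subspace, \<open>T\<close> is determined by \<open>X\<close> (\<open>compress_inj\<close>).

  Conversely, let \<open>X\<close> be a bounded range martingale, and let \<open>T\<^sub>n\<close> be the sum of
  \<open>emb w \<circ> X w \<circ> coemb w\<close> over the words of length \<open>n\<close>.  By Bessel's inequality the \<open>T\<^sub>n\<close> are uniformly
  bounded.  By the martingale property \<open>\<langle>T\<^sub>k a, b\<rangle>\<close> does not depend on \<open>k \<ge> n\<close> for \<open>a\<close> and \<open>b\<close> in the
  range of \<open>U\<^sub>n\<close>, so the \<open>T\<^sub>n\<close> converge weakly to a self-adjoint operator (\<open>weak_limit_selfadjoint\<close>),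
  which has the blocks \<open>X w\<close>.  For \<open>n \<ge> length w\<close>, \<open>T\<^sub>n\<close> commutes with \<open>P (cyl m w)\<close>;
  hence so does the limit, and it commutes with all of \<open>P\<close> because the cylinders generate the
  measurable sets (\<open>povm_commute_cyl\<close>).

  The operators in the definition of the dilation have to be shown to exist: adjoints come from the
  Riesz representation theorem (\<open>adj_on_cinner\<close>), square roots of positive operators from the binomial
  series (\<open>sqrt_op\<close>), and edge contractions from the estimate
  \<open>\<parallel>rsqrt m E (w @ [j]) h\<parallel> \<le> \<parallel>rsqrt m E w h\<parallel>\<close> and extension by continuity (\<open>edge_bounded_ops\<close>).\<close>

section \<open>Inner products\<close>

lemma norm_scaleC [simp]: "norm (c *\<^sub>C (x::'a::chilbert_space)) = cmod c * norm x"
proof -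
  have "cinner (c *\<^sub>C x) (c *\<^sub>C x) = c * (cnj c * cinner x x)"
    by (metis cinner_scaleC_left cinner_commute complex_cnj_mult)
  then have "complex_of_real ((norm (c *\<^sub>C x))\<^sup>2) = complex_of_real ((cmod c * norm x)\<^sup>2)"
    unfolding cinner_self
    by (simp only: power_mult_distrib of_real_mult complex_norm_square mult.assoc)
  then have "(norm (c *\<^sub>C x))\<^sup>2 = (cmod c * norm x)\<^sup>2"
    by (simp only: of_real_eq_iff)
  then show ?thesis by (simp add: power2_eq_iff_nonneg)
qed

lemma scaleC_bounded_linear: "bounded_linear (\<lambda>x::'a::chilbert_space. c *\<^sub>C x)"
proof (rule bounded_linear_intro[where K = "cmod c"])
  fix x y :: 'a and r :: real
  show "c *\<^sub>C (x + y) = c *\<^sub>C x + c *\<^sub>C y"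
    by (rule scaleC_add_right)
  show "c *\<^sub>C (r *\<^sub>R x) = r *\<^sub>R (c *\<^sub>C x)"
    by (simp add: scaleR_scaleC scaleC_scaleC mult.commute)
  show "norm (c *\<^sub>C x) \<le> norm x * cmod c" by simp
qed

lemma scaleC_zero_right [simp]: "c *\<^sub>C (0::'a::chilbert_space) = 0"
  using scaleC_bounded_linear linear_0 bounded_linear.linear by blast

lemma scaleC_minus_one: "(-1) *\<^sub>C (x::'a::chilbert_space) = - x"
  using scaleR_scaleC[of "-1" x] by simp

lemma cinner_add_right: "cinner (x::'a::chilbert_space) (y + z) = cinner x y + cinner x z"
  by (metis cinner_add_left cinner_commute complex_cnj_add)

lemma cinner_scaleC_right: "cinner (x::'a::chilbert_space) (c *\<^sub>C y) = cnj c * cinner x y"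
  by (metis cinner_scaleC_left cinner_commute complex_cnj_mult)

lemma cinner_scaleR_left: "cinner (r *\<^sub>R x) (y::'a::chilbert_space) = r *\<^sub>R cinner x y"
  by (simp add: scaleR_scaleC[of r x] cinner_scaleC_left scaleR_conv_of_real)

lemma cinner_scaleR_right: "cinner (x::'a::chilbert_space) (r *\<^sub>R y) = r *\<^sub>R cinner x y"
  by (simp add: scaleR_scaleC[of r y] cinner_scaleC_right scaleR_conv_of_real)

lemma Re_cinner_self: "Re (cinner x x) = (norm (x::'a::chilbert_space))\<^sup>2"
  by (simp add: cinner_self)

lemma norm_add_square:
  "(norm (x + y))\<^sup>2 = (norm x)\<^sup>2 + 2 * Re (cinner x y) + (norm (y::'a::chilbert_space))\<^sup>2"
proof -
  have "Re (cinner y x) = Re (cinner x y)"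
    by (subst cinner_commute) simp
  then show ?thesis
    unfolding Re_cinner_self[symmetric] by (simp add: cinner_add_left cinner_add_right)
qed

lemma cauchy_schwarz: "cmod (cinner x y) \<le> norm x * norm (y::'a::chilbert_space)"
proof (cases "y = 0")
  case True
  have "cinner x (0 *\<^sub>C y) = 0"
    by (simp only: cinner_scaleC_right) simp
  then show ?thesis using True by simp
next
  case False
  define a where "a = (norm y)\<^sup>2"
  define c where "c = - cinner x y / complex_of_real a"
  have a: "a > 0" using False by (simp add: a_def)
  have "cnj c * cinner x y = - complex_of_real ((cmod (cinner x y))\<^sup>2 / a)"
    by (simp add: c_def complex_norm_square mult.commute del: of_real_power)
  then have 1: "Re (cinner x (c *\<^sub>C y)) = - ((cmod (cinner x y))\<^sup>2 / a)"
    by (simp add: cinner_scaleC_right)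
  have 2: "(norm (c *\<^sub>C y))\<^sup>2 = (cmod (cinner x y))\<^sup>2 / a"
    using a by (simp add: c_def power_mult_distrib norm_divide power_divide a_def[symmetric])
       (simp add: power2_eq_square)
  have "0 \<le> (norm (x + c *\<^sub>C y))\<^sup>2" by simp
  also have "\<dots> = (norm x)\<^sup>2 - (cmod (cinner x y))\<^sup>2 / a"
    using 1 2 by (simp add: norm_add_square)
  finally have "(cmod (cinner x y))\<^sup>2 \<le> (norm x * norm y)\<^sup>2"
    using a by (simp add: field_simps a_def power_mult_distrib)
  then show ?thesis
    by (rule power2_le_imp_le) simp
qed

interpretation cinner: bounded_bilinear "cinner :: 'a::chilbert_space \<Rightarrow> 'a \<Rightarrow> complex"
proof
  fix x x' y y' :: 'a and r :: real
  show "cinner (x + x') y = cinner x y + cinner x' y" by (rule cinner_add_left)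
  show "cinner x (y + y') = cinner x y + cinner x y'" by (rule cinner_add_right)
  show "cinner (r *\<^sub>R x) y = r *\<^sub>R cinner x y" by (rule cinner_scaleR_left)
  show "cinner x (r *\<^sub>R y) = r *\<^sub>R cinner x y" by (rule cinner_scaleR_right)
  show "\<exists>K. \<forall>a b::'a. norm (cinner a b) \<le> norm a * norm b * K"
    by (rule exI[of _ 1]) (simp add: cauchy_schwarz)
qed

lemma parallelogram:
  "(norm (x + y))\<^sup>2 + (norm (x - y))\<^sup>2 = 2 * (norm x)\<^sup>2 + 2 * (norm (y::'a::chilbert_space))\<^sup>2"
  using norm_add_square[of x y] norm_add_square[of x "- y"] by (simp add: cinner.minus_right)

lemma cinner_eq_zero_dense:
  fixes y :: "'a::chilbert_space"
  assumes "\<And>x. x \<in> D \<Longrightarrow> cinner y x = 0" and "y \<in> closure D"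
  shows "y = 0"
proof -
  have "closure D \<subseteq> {x. cinner y x = 0}"
  proof (rule closure_minimal)
    show "D \<subseteq> {x. cinner y x = 0}" using assms(1) by auto
    show "closed {x. cinner y x = 0}"
      by (intro closed_Collect_eq continuous_intros linear_continuous_on
          cinner.bounded_linear_right)
  qed
  then have "cinner y y = 0" using assms(2) by auto
  then show ?thesis by (simp add: cinner_self)
qed

section \<open>The Riesz representation theorem and adjoints\<close>

text \<open>Closed complex-linear subspaces.\<close>

definition closed_csubspace :: "'a::chilbert_space set \<Rightarrow> bool"
  where "closed_csubspace M \<longleftrightarrow> closed M \<and> 0 \<in> M \<and> (\<forall>x\<in>M. \<forall>y\<in>M. x + y \<in> M) \<and>
    (\<forall>c. \<forall>x\<in>M. c *\<^sub>C x \<in> M)"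

lemma closed_csubspace_UNIV [simp]: "closed_csubspace UNIV"
  by (simp add: closed_csubspace_def)

lemma closed_csubspaceD:
  assumes "closed_csubspace M"
  shows "closed M" "0 \<in> M" "x \<in> M \<Longrightarrow> y \<in> M \<Longrightarrow> x + y \<in> M" "x \<in> M \<Longrightarrow> c *\<^sub>C x \<in> M"
    "x \<in> M \<Longrightarrow> y \<in> M \<Longrightarrow> x - y \<in> M" "x \<in> M \<Longrightarrow> r *\<^sub>R x \<in> M"
proof -
  show "closed M" "0 \<in> M" "x \<in> M \<Longrightarrow> y \<in> M \<Longrightarrow> x + y \<in> M" and *: "x \<in> M \<Longrightarrow> c *\<^sub>C x \<in> M"
    for x y c using assms by (auto simp: closed_csubspace_def)
  show "x - y \<in> M" if "x \<in> M" "y \<in> M"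
  proof -
    have "(-1) *\<^sub>C y \<in> M" "\<forall>x\<in>M. \<forall>y\<in>M. x + y \<in> M"
      using assms that unfolding closed_csubspace_def by blast+
    then have "x + (-1) *\<^sub>C y \<in> M" using that by blast
    then show ?thesis by (simp add: scaleC_minus_one)
  qed
  show "r *\<^sub>R x \<in> M" if "x \<in> M"
    using that * by (simp add: scaleR_scaleC)
qed

text \<open>A bounded complex-linear map with domain \<open>M\<close>, which is meant to be a subspace.  Unlike in
  \<^const>\<open>bounded_ops\<close>, the values of \<open>A\<close> outside \<open>M\<close> are arbitrary.\<close>

definition bounded_clinear_on ::
    "'a::chilbert_space set \<Rightarrow> ('a \<Rightarrow> 'b::chilbert_space) \<Rightarrow> bool"
  where "bounded_clinear_on M A \<longleftrightarrow>
    (\<forall>x\<in>M. \<forall>y\<in>M. A (x + y) = A x + A y) \<and>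
    (\<forall>c. \<forall>x\<in>M. A (c *\<^sub>C x) = c *\<^sub>C A x) \<and>
    (\<exists>K. \<forall>x\<in>M. norm (A x) \<le> K * norm x)"

lemma bounded_ops_iff: "A \<in> bounded_ops M N \<longleftrightarrow> A \<in> M \<rightarrow>\<^sub>E N \<and> bounded_clinear_on M A"
  by (simp add: bounded_ops_def bounded_clinear_on_def)

lemma bounded_clinear_onD:
  assumes "bounded_clinear_on M A"
  shows "x \<in> M \<Longrightarrow> y \<in> M \<Longrightarrow> A (x + y) = A x + A y" "x \<in> M \<Longrightarrow> A (c *\<^sub>C x) = c *\<^sub>C A x"
  using assms by (auto simp: bounded_clinear_on_def)

lemma bounded_clinear_on_diff:
  assumes "closed_csubspace M" "bounded_clinear_on M A" "x \<in> M" "y \<in> M"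
  shows "A (x - y) = A x - A y"
proof -
  have "A (x + (-1) *\<^sub>C y) = A x + A ((-1) *\<^sub>C y)"
    using assms closed_csubspaceD(4)[OF assms(1)] by (intro bounded_clinear_onD) auto
  also have "A ((-1) *\<^sub>C y) = (-1) *\<^sub>C A y"
    using assms by (intro bounded_clinear_onD) auto
  finally show ?thesis by (simp add: scaleC_minus_one)
qed

lemma bounded_clinear_on_zero:
  assumes "closed_csubspace M" "bounded_clinear_on M A"
  shows "A 0 = 0"
  using bounded_clinear_on_diff[OF assms, of 0 0] closed_csubspaceD(2)[OF assms(1)] by simp

lemma bounded_clinear_on_bound:
  assumes "bounded_clinear_on M A"
  obtains K where "K > 0" "\<And>x. x \<in> M \<Longrightarrow> norm (A x) \<le> K * norm x"
proof -
  obtain K where K: "\<And>x. x \<in> M \<Longrightarrow> norm (A x) \<le> K * norm x"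
    using assms unfolding bounded_clinear_on_def by blast
  show ?thesis
  proof (rule that[of "max K 1"])
    show "norm (A x) \<le> max K 1 * norm x" if "x \<in> M" for x
      using K[OF that] mult_right_mono[of K "max K 1" "norm x"] by simp
  qed simp
qed

lemma bounded_clinear_on_bounded_linear:
  assumes "bounded_clinear_on UNIV A"
  shows "bounded_linear A"
proof -
  obtain K where "\<And>x. norm (A x) \<le> K * norm x"
    using bounded_clinear_on_bound[OF assms] by auto
  then show ?thesis
    using bounded_clinear_onD[OF assms]
    by (intro bounded_linear_intro[where K = K]) (auto simp: scaleR_scaleC mult.commute)
qed

lemma bounded_clinear_on_continuous:
  assumes "closed_csubspace M" "bounded_clinear_on M A"
  shows "continuous_on M A"
proof -
  obtain K where K: "K > 0" "\<And>x. x \<in> M \<Longrightarrow> norm (A x) \<le> K * norm x"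
    using bounded_clinear_on_bound[OF assms(2)] by auto
  have "K-lipschitz_on M A"
    unfolding lipschitz_on_def dist_norm
    using K closed_csubspaceD(5)[OF assms(1)] bounded_clinear_on_diff[OF assms]
    by (metis less_imp_le)
  then show ?thesis by (rule lipschitz_on_continuous_on)
qed

text \<open>The representing vector minimises \<open>\<parallel>z\<parallel>\<^sup>2 - 2 Re (f z)\<close> over \<open>M\<close>; a minimising sequence is
  Cauchy by the parallelogram law.\<close>

lemma riesz_representation:
  fixes M :: "'a::chilbert_space set" and f :: "'a \<Rightarrow> complex"
  assumes M: "closed_csubspace M" and f: "bounded_clinear_on M f"
  obtains x where "x \<in> M" "\<And>z. z \<in> M \<Longrightarrow> f z = cinner z x"
proof -
  note M' = closed_csubspaceD[OF M]
  obtain K where K: "K > 0" "\<And>x. x \<in> M \<Longrightarrow> norm (f x) \<le> K * norm x"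
    using bounded_clinear_on_bound[OF f] by auto
  have add: "f (x + y) = f x + f y" if "x \<in> M" "y \<in> M" for x y
    using bounded_clinear_onD(1)[OF f] that by auto
  have scaleC: "f (c *\<^sub>C x) = c * f x" if "x \<in> M" for x c
    using bounded_clinear_onD(2)[OF f] that by (auto simp: scaleC_complex_def)
  have scaleR: "f (c *\<^sub>R x) = c *\<^sub>R f x" if "x \<in> M" for x c
    using scaleC[OF that, of "complex_of_real c"]
    by (simp add: scaleR_scaleC[of c x] scaleR_conv_of_real)
  define q where "q z = (norm z)\<^sup>2 - 2 * Re (f z)" for z
  have lower: "q z \<ge> - (K\<^sup>2)" if "z \<in> M" for z
  proof -
    have "Re (f z) \<le> K * norm z"
      using K(2)[OF that] complex_Re_le_cmod[of "f z"] by linarith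
    moreover have "0 \<le> (norm z - K)\<^sup>2" by simp
    ultimately show ?thesis unfolding q_def power2_diff by (simp add: mult.commute)
  qed
  define d where "d = (INF z\<in>M. q z)"
  have bdd: "bdd_below (q ` M)" using lower by (auto intro!: bdd_belowI)
  have d: "d \<le> q z" if "z \<in> M" for z
    unfolding d_def using bdd that by (rule cINF_lower)
  have "\<exists>z\<in>M. q z < d + 1 / real (Suc n)" for n
  proof -
    have "(INF z\<in>M. q z) < d + 1 / real (Suc n)" by (simp add: d_def)
    then show ?thesis using cINF_less_iff[OF _ bdd] M'(2) by blast
  qed
  then obtain s where s: "\<And>n. s n \<in> M" "\<And>n. q (s n) < d + 1 / real (Suc n)"
    by metis
  have par: "(norm (a - b))\<^sup>2 \<le> 2 * (q a - d) + 2 * (q b - d)" if "a \<in> M" "b \<in> M" for a b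
  proof -
    have *: "(1/2) *\<^sub>R (a + b) \<in> M" using that by (intro M'(6) M'(3))
    have "q ((1/2) *\<^sub>R (a + b)) = (norm (a + b))\<^sup>2 / 4 - Re (f a) - Re (f b)"
      using that by (simp add: q_def scaleR add M'(3) power_divide add_divide_distrib)
    then have "4 * d \<le> (norm (a + b))\<^sup>2 - 4 * Re (f a) - 4 * Re (f b)"
      using d[OF *] by simp
    then show ?thesis using parallelogram[of a b] unfolding q_def by simp
  qed
  have "Cauchy s"
  proof (rule metric_CauchyI)
    fix e :: real assume "e > 0"
    then obtain N where N: "1 / real (Suc N) < e\<^sup>2 / 4"
      using nat_approx_posE[of "e\<^sup>2 / 4"] by (auto simp del: of_nat_Suc)
    have "dist (s i) (s j) < e" if "i \<ge> N" "j \<ge> N" for i j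
    proof -
      have lt: "q (s k) - d < e\<^sup>2 / 4" if "k \<ge> N" for k
      proof -
        have "1 / real (Suc k) \<le> 1 / real (Suc N)" using that by (simp add: frac_le)
        then show ?thesis using s(2)[of k] N by (simp del: of_nat_Suc)
      qed
      have "(norm (s i - s j))\<^sup>2 \<le> 2 * (q (s i) - d) + 2 * (q (s j) - d)"
        using par s(1) by blast
      also have "\<dots> < e\<^sup>2"
        using lt[OF that(1)] lt[OF that(2)] by simp
      finally show ?thesis
        using \<open>e > 0\<close> by (simp add: dist_norm power_less_imp_less_base)
    qed
    then show "\<exists>N. \<forall>i\<ge>N. \<forall>j\<ge>N. dist (s i) (s j) < e" by blast
  qed
  then obtain x where x: "s \<longlonglongrightarrow> x"
    using Cauchy_convergent_iff convergent_def by blast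
  have "x \<in> M" using closed_sequentially[OF M'(1)] s(1) x by blast
  have qc: "continuous_on M q"
    unfolding q_def using bounded_clinear_on_continuous[OF M f] by (intro continuous_intros)
  have "(\<lambda>n. q (s n)) \<longlonglongrightarrow> q x"
    using continuous_on_tendsto_compose[OF qc x \<open>x \<in> M\<close>] s(1) by simp
  moreover have "(\<lambda>n. d + 1 / real (Suc n)) \<longlonglongrightarrow> d + 0"
    by (intro tendsto_add tendsto_const) (use LIMSEQ_inverse_real_of_nat in \<open>simp add: field_simps\<close>)
  ultimately have "q x \<le> d + 0"
    using s(2) by (intro LIMSEQ_le) (auto intro: less_imp_le)
  then have min: "q x \<le> q z" if "z \<in> M" for z using d[OF that] by simp
  \<comment> \<open>first variation of \<open>q\<close> at the minimiser, with the \<open>t\<close> that minimises the quadratic bound\<close>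
  have Re: "Re (f z) = Re (cinner x z)" if z: "z \<in> M" for z
  proof -
    define b where "b = Re (cinner x z) - Re (f z)"
    define p where "p = (norm z)\<^sup>2 + 1"
    define t where "t = - b / p"
    have p: "p > 0" by (simp add: p_def add_nonneg_pos)
    have "q (x + t *\<^sub>R z) = q x + 2 * t * b + t\<^sup>2 * (norm z)\<^sup>2"
      using z \<open>x \<in> M\<close>
      by (simp add: q_def norm_add_square add scaleR M'(6) cinner.scaleR_right b_def algebra_simps
          power_mult_distrib)
    moreover have "q x \<le> q (x + t *\<^sub>R z)" using z \<open>x \<in> M\<close> by (intro min M'(3) M'(6))
    ultimately have "0 \<le> 2 * t * b + t\<^sup>2 * (norm z)\<^sup>2" by simp
    also have "\<dots> \<le> 2 * t * b + t\<^sup>2 * p" by (simp add: p_def algebra_simps)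
    also have "\<dots> = - (b\<^sup>2 / p)"
      using p by (simp add: t_def power2_eq_square)
    finally have "b\<^sup>2 / p \<le> 0" by simp
    then have "b = 0" using p by (simp add: divide_le_0_iff)
    then show ?thesis by (simp add: b_def)
  qed
  show ?thesis
  proof (rule that[OF \<open>x \<in> M\<close>])
    fix z assume z: "z \<in> M"
    have sym: "Re (cinner u x) = Re (cinner x u)" for u
      by (subst cinner_commute) simp
    \<comment> \<open>the imaginary parts are the real parts at \<open>\<i> *\<^sub>C z\<close>, up to sign\<close>
    have "Re (f (\<i> *\<^sub>C z)) = Re (cinner x (\<i> *\<^sub>C z))" using z by (intro Re M'(4))
    then have "Re (f (\<i> *\<^sub>C z)) = Re (cinner (\<i> *\<^sub>C z) x)" by (simp only: sym)
    then have "Im (f z) = Im (cinner z x)"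
      using z by (simp add: scaleC cinner_scaleC_left)
    then show "f z = cinner z x" using Re[OF z] sym by (simp add: complex_eq_iff)
  qed
qed

text \<open>The definition of \<^const>\<open>adj_on\<close> is meaningful for every bounded operator on a closed subspace: the
  vector \<open>adj_on M cinner cinner A y\<close> represents the functional \<open>z \<mapsto> \<langle>A z, y\<rangle>\<close>.\<close>

lemma adj_on_cinner:
  assumes M: "closed_csubspace M" and A: "bounded_clinear_on M A"
  shows "adj_on M cinner cinner A y \<in> M"
    and "z \<in> M \<Longrightarrow> cinner (A z) y = cinner z (adj_on M cinner cinner A y)"
proof -
  have "bounded_clinear_on M (\<lambda>z. cinner (A z) y)"
  proof -
    obtain K where K: "K > 0" "\<And>x. x \<in> M \<Longrightarrow> norm (A x) \<le> K * norm x"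
      using bounded_clinear_on_bound[OF A] by auto
    have "cmod (cinner (A z) y) \<le> (K * norm y) * norm z" if "z \<in> M" for z
      using cauchy_schwarz[of "A z" y] mult_right_mono[OF K(2)[OF that], of "norm y"]
      by (simp add: mult_ac)
    then show ?thesis
      using bounded_clinear_onD[OF A] unfolding bounded_clinear_on_def
      by (auto simp: cinner_add_left cinner_scaleC_left scaleC_complex_def)
  qed
  then obtain x where x: "x \<in> M" "\<And>z. z \<in> M \<Longrightarrow> cinner (A z) y = cinner z x"
    using riesz_representation[OF M] by metis
  have uniq: "x' = x" if "x' \<in> M" "\<forall>z\<in>M. cinner (A z) y = cinner z x'" for x'
  proof -
    have "x' - x \<in> M" using x(1) that(1) by (intro closed_csubspaceD(5)[OF M])
    then have "cinner (x' - x) x' = cinner (x' - x) x" using x that by metis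
    then have "cinner (x' - x) (x' - x) = 0"
      by (simp only: cinner.diff_right) simp
    then show ?thesis by (simp add: cinner_self)
  qed
  have "adj_on M cinner cinner A y \<in> M \<and>
    (\<forall>z\<in>M. cinner (A z) y = cinner z (adj_on M cinner cinner A y))"
    unfolding adj_on_def by (rule theI[of _ x]) (use x uniq in blast)+
  then show "adj_on M cinner cinner A y \<in> M"
    and "z \<in> M \<Longrightarrow> cinner (A z) y = cinner z (adj_on M cinner cinner A y)" by simp_all
qed

lemma csubspace_cinner_ext:
  assumes M: "closed_csubspace M" and "x \<in> M" "y \<in> M"
    and eq: "\<And>z. z \<in> M \<Longrightarrow> cinner z x = cinner z y"
  shows "x = y"
proof -
  have "cinner (x - y) (x - y) = cinner (x - y) x - cinner (x - y) y"
    by (rule cinner.diff_right)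
  also have "\<dots> = 0" using eq closed_csubspaceD(5)[OF M assms(2,3)] by simp
  finally show ?thesis by (simp add: cinner_self)
qed

lemma adj_on_norm_le:
  assumes M: "closed_csubspace M" and A: "bounded_clinear_on M A"
    and K: "K \<ge> 0" "\<And>z. z \<in> M \<Longrightarrow> norm (A z) \<le> K * norm z"
  shows "norm (adj_on M cinner cinner A y) \<le> K * norm y"
proof -
  define a where "a = adj_on M cinner cinner A y"
  have a: "a \<in> M" "cinner (A a) y = cinner a a"
    using adj_on_cinner[OF M A] by (auto simp: a_def)
  have "norm a * norm a = cmod (cinner (A a) y)"
    by (simp add: a cinner_self norm_mult power2_eq_square)
  also have "\<dots> \<le> norm (A a) * norm y" by (rule cauchy_schwarz)
  also have "\<dots> \<le> (K * norm a) * norm y" using K(2)[OF a(1)] by (rule mult_right_mono) simp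
  finally have "norm a * norm a \<le> (K * norm y) * norm a" by (simp add: mult_ac)
  then have "norm a \<le> K * norm y"
    using K(1) by (cases "a = 0") (auto dest: mult_right_le_imp_le)
  then show ?thesis by (simp add: a_def)
qed

lemma adj_on_bounded_clinear:
  assumes M: "closed_csubspace M" and A: "bounded_clinear_on M A"
  shows "bounded_clinear_on UNIV (adj_on M cinner cinner A)" (is "bounded_clinear_on _ ?B")
proof -
  obtain K where K: "K > 0" "\<And>z. z \<in> M \<Longrightarrow> norm (A z) \<le> K * norm z"
    using bounded_clinear_on_bound[OF A] by auto
  note in_M = adj_on_cinner(1)[OF M A] and adj = adj_on_cinner(2)[OF M A, symmetric]
  have "?B (x + y) = ?B x + ?B y" for x y
    by (rule csubspace_cinner_ext[OF M])
       (simp_all add: in_M closed_csubspaceD(3)[OF M] cinner_add_right adj)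
  moreover have "?B (c *\<^sub>C x) = c *\<^sub>C ?B x" for c x
    by (rule csubspace_cinner_ext[OF M])
       (simp_all add: in_M closed_csubspaceD(4)[OF M] cinner_scaleC_right adj)
  moreover have "norm (?B x) \<le> K * norm x" for x
    using adj_on_norm_le[OF M A, of K] K by simp
  ultimately show ?thesis unfolding bounded_clinear_on_def by blast
qed

lemma bounded_clinear_on_compose:
  assumes A: "bounded_clinear_on M A" "\<And>x. x \<in> M \<Longrightarrow> A x \<in> N" and B: "bounded_clinear_on N B"
  shows "bounded_clinear_on M (\<lambda>x. B (A x))"
proof -
  obtain K where K: "K > 0" "\<And>x. x \<in> M \<Longrightarrow> norm (A x) \<le> K * norm x"
    using bounded_clinear_on_bound[OF A(1)] by auto
  obtain L where L: "L > 0" "\<And>x. x \<in> N \<Longrightarrow> norm (B x) \<le> L * norm x"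
    using bounded_clinear_on_bound[OF B] by auto
  have "norm (B (A x)) \<le> (L * K) * norm x" if "x \<in> M" for x
    using order_trans[OF L(2)[OF A(2)[OF that]] mult_left_mono[OF K(2)[OF that], of L]] L(1)
    by (simp add: mult.assoc)
  moreover have "B (A (x + y)) = B (A x) + B (A y)" if "x \<in> M" "y \<in> M" for x y
    using bounded_clinear_onD(1)[OF A(1) that] bounded_clinear_onD(1)[OF B A(2) A(2), OF that] by simp
  moreover have "B (A (c *\<^sub>C x)) = c *\<^sub>C B (A x)" if "x \<in> M" for c x
    using bounded_clinear_onD(2)[OF A(1) that] bounded_clinear_onD(2)[OF B A(2), OF that] by simp
  ultimately show ?thesis unfolding bounded_clinear_on_def by blast
qed

lemma bounded_clinear_on_sum:
  assumes "\<And>i. i \<in> I \<Longrightarrow> bounded_clinear_on M (A i)"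
  shows "bounded_clinear_on M (\<lambda>x. \<Sum>i\<in>I. A i x)"
  using assms
proof (induction I rule: infinite_finite_induct)
  case (insert i I)
  have i: "bounded_clinear_on M (A i)" and I: "bounded_clinear_on M (\<lambda>x. \<Sum>i\<in>I. A i x)"
    using insert by auto
  obtain K where K: "K > 0" "\<And>x. x \<in> M \<Longrightarrow> norm (A i x) \<le> K * norm x"
    using bounded_clinear_on_bound[OF i] by auto
  obtain L where L: "L > 0" "\<And>x. x \<in> M \<Longrightarrow> norm (\<Sum>i\<in>I. A i x) \<le> L * norm x"
    using bounded_clinear_on_bound[OF I] by auto
  have "norm (A i x + (\<Sum>i\<in>I. A i x)) \<le> (K + L) * norm x" if "x \<in> M" for x
    using norm_triangle_le[OF add_mono[OF K(2)[OF that] L(2)[OF that]]] by (simp add: distrib_right)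
  then have "\<exists>K. \<forall>x\<in>M. norm (A i x + (\<Sum>i\<in>I. A i x)) \<le> K * norm x" by blast
  then show ?case
    using bounded_clinear_onD[OF i] bounded_clinear_onD[OF I] insert(1,2)
    unfolding bounded_clinear_on_def by (auto simp: scaleC_add_right algebra_simps)
qed (auto simp: bounded_clinear_on_def intro: exI[of _ 0])

lemma closed_csubspace_sum:
  assumes "closed_csubspace M" "\<And>i. i \<in> I \<Longrightarrow> f i \<in> M"
  shows "(\<Sum>i\<in>I. f i) \<in> M"
  using assms(2)
  by (induction I rule: infinite_finite_induct) (auto intro: closed_csubspaceD[OF assms(1)])

lemma bounded_clinear_on_sum_distrib:
  assumes M: "closed_csubspace M" and A: "bounded_clinear_on M A" and f: "\<And>i. i \<in> I \<Longrightarrow> f i \<in> M"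
  shows "A (\<Sum>i\<in>I. f i) = (\<Sum>i\<in>I. A (f i))"
  using f
proof (induction I rule: infinite_finite_induct)
  case (insert i I)
  then show ?case
    using bounded_clinear_onD(1)[OF A, of "f i" "\<Sum>i\<in>I. f i"] closed_csubspace_sum[OF M, of I f]
    by simp
qed (simp_all add: bounded_clinear_on_zero[OF M A])

section \<open>Weak limits of self-adjoint operators\<close>

lemma selfadjoint_on_UNIV_iff:
  "selfadjoint_on UNIV A \<longleftrightarrow> bounded_clinear_on UNIV A \<and> (\<forall>x y. cinner (A x) y = cinner x (A y))"
  by (simp add: selfadjoint_on_def bounded_ops_iff)

text \<open>A uniformly bounded sequence of additive maps that converges pointwise on a set converges
  pointwise on its closure.\<close>

lemma convergent_functionals_dense:
  fixes g :: "nat \<Rightarrow> 'a::real_normed_vector \<Rightarrow> 'b::banach"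
  assumes diff: "\<And>n x y. g n (x - y) = g n x - g n y"
    and bound: "\<And>n x. norm (g n x) \<le> c * norm x"
    and D: "\<And>x. x \<in> D \<Longrightarrow> convergent (\<lambda>n. g n x)" and x: "x \<in> closure D"
  shows "convergent (\<lambda>n. g n x)"
proof -
  define b where "b = max c 1"
  have b: "b > 0" "norm (g n u) \<le> b * norm u" for n u
    using bound[of n u] mult_right_mono[of c b "norm u"] by (simp_all add: b_def)
  have "Cauchy (\<lambda>n. g n x)"
  proof (rule metric_CauchyI)
    fix e :: real assume e: "e > 0"
    then have "e / (3 * b) > 0" using b by simp
    then obtain y where y: "y \<in> D" "dist y x < e / (3 * b)"
      using x unfolding closure_approachable by blast
    have "Cauchy (\<lambda>n. g n y)" using D[OF y(1)] by (rule convergent_Cauchy)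
    then obtain N where N: "\<And>i j. i \<ge> N \<Longrightarrow> j \<ge> N \<Longrightarrow> dist (g i y) (g j y) < e / 3"
      using metric_CauchyD[of "\<lambda>n. g n y" "e / 3"] e by auto
    have near: "dist (g i y) (g i x) < e / 3" for i
    proof -
      have "dist (g i y) (g i x) \<le> b * dist y x"
        using b(2)[of i "y - x"] by (simp add: dist_norm diff)
      also have "\<dots> < b * (e / (3 * b))" using y(2) b(1) by (rule mult_strict_left_mono)
      finally show ?thesis using b(1) by simp
    qed
    have "dist (g i x) (g j x) < e" if "i \<ge> N" "j \<ge> N" for i j
      using N[OF that] near[of i] near[of j] dist_triangle[of "g i x" "g j x" "g i y"]
        dist_triangle[of "g i y" "g j x" "g j y"] by (simp add: dist_commute)
    then show "\<exists>N. \<forall>i\<ge>N. \<forall>j\<ge>N. dist (g i x) (g j x) < e" by blast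
  qed
  then show ?thesis by (rule Cauchy_convergent)
qed

text \<open>Weak convergence on a dense set extends to all vectors, one argument at a time; self-adjointness
  moves the second step to the other argument.  The limit form is represented by an operator by
  Riesz.\<close>

lemma weak_limit_selfadjoint:
  fixes T :: "nat \<Rightarrow> 'a::chilbert_space \<Rightarrow> 'a"
  assumes sa: "\<And>n. selfadjoint_on UNIV (T n)"
    and bound: "\<And>n x. norm (T n x) \<le> c * norm x"
    and conv: "\<And>x y. x \<in> D \<Longrightarrow> y \<in> D \<Longrightarrow> convergent (\<lambda>n. cinner (T n x) y)"
    and D: "closure D = UNIV"
  obtains S where "selfadjoint_on UNIV S" "\<And>x y. (\<lambda>n. cinner (T n x) y) \<longlonglongrightarrow> cinner (S x) y"
proof -
  have sym: "cinner (T n x) y = cinner x (T n y)" for n x y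
    using sa by (auto simp: selfadjoint_on_UNIV_iff)
  have bd: "cmod (cinner (T n x) y) \<le> (c * norm x) * norm y" for n x y
    using cauchy_schwarz[of "T n x" y] mult_right_mono[OF bound[of n x], of "norm y"] by simp
  have 1: "convergent (\<lambda>n. cinner (T n x) y)" if "x \<in> D" for x y
  proof (rule convergent_functionals_dense[where D = D and c = "c * norm x"
        and g = "\<lambda>n. cinner (T n x)"])
    show "convergent (\<lambda>n. cinner (T n x) z)" if "z \<in> D" for z
      using conv[OF \<open>x \<in> D\<close> that] .
  qed (simp_all add: D bd cinner.diff_right)
  have 2: "convergent (\<lambda>n. cinner (T n x) y)" for x y
  proof (rule convergent_functionals_dense[where D = D and c = "c * norm y"
        and g = "\<lambda>n x. cinner (T n x) y"])
    show "convergent (\<lambda>n. cinner (T n x) y)" if "x \<in> D" for x using 1[OF that] .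
    show "cmod (cinner (T n x) y) \<le> c * norm y * norm x" for n x
      using bd[of n x y] by (simp add: mult_ac)
  qed (simp_all add: D sym cinner.diff_left)
  \<comment> \<open>the limit form is linear in its first argument, as Riesz requires\<close>
  define b where "b z x = lim (\<lambda>n. cinner z (T n x))" for z x
  have b: "(\<lambda>n. cinner z (T n x)) \<longlonglongrightarrow> b z x" for z x
    using 2[of z x] unfolding b_def by (simp add: sym convergent_LIMSEQ_iff)
  have "bounded_clinear_on UNIV (\<lambda>z. b z x)" for x
    unfolding bounded_clinear_on_def
  proof (intro conjI ballI allI exI)
    fix z y k
    show "b (z + y) x = b z x + b y x"
      by (rule LIMSEQ_unique[OF b]) (simp add: cinner_add_left tendsto_add[OF b b])
    show "b (k *\<^sub>C z) x = k *\<^sub>C b z x"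
      unfolding scaleC_complex_def
      by (rule LIMSEQ_unique[OF b]) (simp add: cinner_scaleC_left tendsto_mult_left[OF b])
    have "cmod (cinner z (T n x)) \<le> (c * norm x) * norm z" for n
      using bd[of n z x] by (simp add: sym mult_ac)
    then show "cmod (b z x) \<le> (c * norm x) * norm z"
      by (intro LIMSEQ_le_const2[OF tendsto_norm[OF b]]) auto
  qed
  then have "\<exists>w. \<forall>z. b z x = cinner z w" for x
    using riesz_representation[OF closed_csubspace_UNIV] by (metis UNIV_I)
  then obtain S where S: "\<And>z x. b z x = cinner z (S x)" by metis
  have lim: "(\<lambda>n. cinner z (T n x)) \<longlonglongrightarrow> cinner z (S x)" for z x
    using b S by simp
  have lim': "(\<lambda>n. cinner (T n x) z) \<longlonglongrightarrow> cinner (S x) z" for z x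
    using tendsto_cnj[OF lim[of z x]] by (simp only: cinner_commute[symmetric])
  have symS: "cinner (S x) y = cinner x (S y)" for x y
    by (rule LIMSEQ_unique[OF lim']) (simp add: sym lim)
  have ext: "u = v" if "\<And>z::'a. cinner z u = cinner z v" for u v
  proof -
    have "cinner (u - v) (u - v) = 0" by (simp only: cinner.diff_right that) simp
    then show ?thesis by (simp add: cinner_self)
  qed
  have "bounded_clinear_on UNIV S"
    unfolding bounded_clinear_on_def
  proof (intro conjI ballI allI exI)
    fix x y k
    show "S (x + y) = S x + S y"
      by (rule ext) (simp add: symS[symmetric] cinner_add_left cinner_add_right)
    show "S (k *\<^sub>C x) = k *\<^sub>C S x"
      by (rule ext) (simp add: symS[symmetric] cinner_scaleC_right)
    have "cmod (cinner (S x) (S x)) \<le> c * norm x * norm (S x)"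
      by (rule LIMSEQ_le_const2[OF tendsto_norm[OF lim']]) (use bd in auto)
    then have "norm (S x) * norm (S x) \<le> c * norm x * norm (S x)"
      by (simp add: cinner_self power2_eq_square norm_mult)
    moreover have "0 \<le> c * norm x"
      using order_trans[OF norm_ge_zero bound] .
    ultimately show "norm (S x) \<le> c * norm x"
      by (cases "S x = 0") (auto dest: mult_right_le_imp_le)
  qed
  then have "selfadjoint_on UNIV S" by (simp add: selfadjoint_on_UNIV_iff symS)
  then show ?thesis using that lim' by blast
qed

section \<open>Square roots of positive operators\<close>

lemma positive_op_iff:
  "positive_op A \<longleftrightarrow> bounded_clinear_on UNIV A \<and> (\<forall>x y. cinner (A x) y = cinner x (A y)) \<and>
    (\<forall>x. 0 \<le> Re (cinner (A x) x))"
  by (simp add: positive_op_def selfadjoint_on_UNIV_iff)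

text \<open>The quadratic form of \<open>A\<close> controls \<open>\<parallel>A x\<parallel>\<close>.  Taken with \<open>c = 1\<close> this makes \<open>I - A\<close> a contraction;
  it also shows that \<open>A x = 0\<close> whenever the form vanishes at \<open>x\<close>.\<close>

lemma positive_op_norm_le:
  assumes A: "positive_op A" and c: "c > 0" "\<And>x. norm (A x) \<le> c * norm x"
  shows "(norm (A x))\<^sup>2 \<le> c * Re (cinner (A x) x)"
proof -
  have lin: "bounded_linear A" and sym: "cinner (A x) y = cinner x (A y)" for x y
    using A by (auto simp: positive_op_iff intro: bounded_clinear_on_bounded_linear)
  interpret A: bounded_linear A by (rule lin)
  define t where "t = 1 / c"
  have t: "t > 0" "c * t = 1" using c by (simp_all add: t_def)
  have "Re (cinner (A (A x)) (A x)) \<le> norm (A (A x)) * norm (A x)"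
    using complex_Re_le_cmod cauchy_schwarz order_trans by blast
  also have "\<dots> \<le> c * (norm (A x))\<^sup>2"
    using mult_right_mono[OF c(2)[of "A x"], of "norm (A x)"] by (simp add: power2_eq_square mult.assoc)
  finally have 1: "Re (cinner (A (A x)) (A x)) \<le> c * (norm (A x))\<^sup>2" .
  \<comment> \<open>positivity at \<open>x - A x / c\<close>\<close>
  have "0 \<le> Re (cinner (A (x - t *\<^sub>R A x)) (x - t *\<^sub>R A x))"
    using A unfolding positive_op_iff by blast
  also have "\<dots> = Re (cinner (A x) x) - 2 * t * (norm (A x))\<^sup>2 + t * t * Re (cinner (A (A x)) (A x))"
    by (simp add: A.diff A.scaleR cinner.diff_left cinner.diff_right cinner.scaleR_left
        cinner.scaleR_right Re_cinner_self[symmetric] sym[of "A x" x] algebra_simps)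
  also have "\<dots> \<le> Re (cinner (A x) x) - 2 * t * (norm (A x))\<^sup>2 + t * t * (c * (norm (A x))\<^sup>2)"
    using 1 t by (intro add_left_mono mult_left_mono) auto
  also have "t * t * (c * (norm (A x))\<^sup>2) = t * (norm (A x))\<^sup>2"
    using t(2) by (simp add: mult_ac)
  finally have "t * (norm (A x))\<^sup>2 \<le> Re (cinner (A x) x)" by simp
  then have "c * (t * (norm (A x))\<^sup>2) \<le> c * Re (cinner (A x) x)"
    using c(1) by (intro mult_left_mono) auto
  then show ?thesis using t(2) by (simp add: mult.assoc[symmetric])
qed

lemma positive_op_eq_zero:
  assumes A: "positive_op A" and "Re (cinner (A x) x) = 0"
  shows "A x = 0"
proof -
  have "bounded_clinear_on UNIV A" using A by (simp add: positive_op_iff)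
  then obtain c where "c > 0" "\<And>x. norm (A x) \<le> c * norm x"
    using bounded_clinear_on_bound by (metis UNIV_I)
  then have "(norm (A x))\<^sup>2 \<le> c * Re (cinner (A x) x)"
    by (intro positive_op_norm_le A)
  then show ?thesis using assms(2) by simp
qed

text \<open>The coefficients of the power series of \<open>sqrt (1 - t)\<close>.\<close>

definition sqrt_coeff :: "nat \<Rightarrow> real"
  where "sqrt_coeff k = ((1/2) gchoose k) * (-1) ^ k"

lemma sqrt_coeff_0 [simp]: "sqrt_coeff 0 = 1"
  by (simp add: sqrt_coeff_def)

lemma sqrt_coeff_nonpos: "sqrt_coeff (Suc k) \<le> 0"
proof (induction k)
  case 0
  show ?case by (simp add: sqrt_coeff_def)
next
  case (Suc k)
  have "real (Suc (Suc k)) * sqrt_coeff (Suc (Suc k)) = (real (Suc k) - 1/2) * sqrt_coeff (Suc k)"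
  proof -
    have "real (Suc (Suc k)) * ((1/2) gchoose Suc (Suc k)) = (1/2 - real (Suc k)) * ((1/2) gchoose Suc k)"
      using gbinomial_mult_1[of "1/2::real" "Suc k"] unfolding left_diff_distrib by linarith
    then have "real (Suc (Suc k)) * ((1/2) gchoose Suc (Suc k)) * (-1) ^ Suc (Suc k) =
        (1/2 - real (Suc k)) * ((1/2) gchoose Suc k) * (-1) ^ Suc (Suc k)"
      by (simp only:)
    then show ?thesis unfolding sqrt_coeff_def by (simp add: algebra_simps)
  qed
  also have "\<dots> \<le> 0" using Suc by (intro mult_nonneg_nonpos) auto
  finally show ?case by (simp add: mult_le_0_iff)
qed

text \<open>As the coefficients after the first are not positive, this bounds the sum of their absolute values;
  it also makes the square root positive.\<close>

lemma sqrt_coeff_sum_nonneg: "0 \<le> (\<Sum>k\<le>n. sqrt_coeff k)"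
proof -
  define r where "r n = (-1) ^ n * ((-1/2::real) gchoose n)" for n
  have "0 \<le> r n"
  proof (induction n)
    case 0
    show ?case by (simp add: r_def)
  next
    case (Suc n)
    have "real (Suc n) * r (Suc n) = (real n + 1/2) * r n"
    proof -
      have "real (Suc n) * ((-1/2) gchoose Suc n) = (-1/2 - real n) * ((-1/2) gchoose n)"
        using gbinomial_mult_1[of "-1/2::real" n] unfolding left_diff_distrib by linarith
      moreover have "real (Suc n) * r (Suc n) = (real (Suc n) * ((-1/2) gchoose Suc n)) * (-1) ^ Suc n"
        by (simp only: r_def mult_ac)
      moreover have "(real n + 1/2) * r n = ((-1/2 - real n) * ((-1/2) gchoose n)) * (-1) ^ Suc n"
        unfolding r_def power_Suc by algebra
      ultimately show ?thesis by simp
    qed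
    moreover have "0 \<le> (real n + 1/2) * r n" using Suc by simp
    ultimately have "0 \<le> real (Suc n) * r (Suc n)" by simp
    then show ?case by (simp add: zero_le_mult_iff)
  qed
  then show ?thesis
    using gbinomial_sum_lower_neg[of "1/2::real" n] by (simp add: sqrt_coeff_def r_def)
qed

lemma sqrt_coeff_summable: "summable (\<lambda>k. \<bar>sqrt_coeff k\<bar>)"
proof (rule bounded_imp_summable)
  fix n
  have "(\<Sum>k\<le>n. \<bar>sqrt_coeff k\<bar>) = 2 - (\<Sum>k\<le>n. sqrt_coeff k)"
    by (induction n) (simp_all add: abs_of_nonpos sqrt_coeff_nonpos)
  then show "(\<Sum>k\<le>n. \<bar>sqrt_coeff k\<bar>) \<le> 2" using sqrt_coeff_sum_nonneg[of n] by simp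
qed simp

text \<open>The coefficients of \<open>sqrt (1 - t) * sqrt (1 - t) = 1 - t\<close>.\<close>

lemma sqrt_coeff_convolution:
  "(\<Sum>i\<le>n. sqrt_coeff i * sqrt_coeff (n - i)) = (if n = 0 then 1 else if n = 1 then -1 else 0)"
proof -
  have "(\<Sum>i\<le>n. sqrt_coeff i * sqrt_coeff (n - i)) =
      (\<Sum>i\<in>{0..n}. ((1/2) gchoose i) * ((1/2) gchoose (n - i)) * (-1) ^ n)"
    unfolding atLeast0AtMost
  proof (rule sum.cong[OF refl])
    fix i assume "i \<in> {..n}"
    then have "(-1) ^ n = (-1) ^ i * (-1::real) ^ (n - i)" by (simp add: power_add[symmetric])
    then show "sqrt_coeff i * sqrt_coeff (n - i) =
        ((1/2) gchoose i) * ((1/2) gchoose (n - i)) * (-1) ^ n"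
      by (simp add: sqrt_coeff_def)
  qed
  also have "\<dots> = (1 gchoose n) * (-1) ^ n"
    by (simp only: sum_distrib_right[symmetric] gbinomial_Vandermonde) simp
  also have "(1::real) gchoose n = real (1 choose n)"
    using binomial_gbinomial[of 1 n, where 'a = real] by simp
  also have "\<dots> * (-1) ^ n = (if n = 0 then 1 else if n = 1 then -1 else 0)"
    by (cases n) (auto simp: binomial_eq_0)
  finally show ?thesis .
qed

lemma infsum_eq_suminf:
  fixes f :: "nat \<Rightarrow> 'a::banach"
  assumes "summable (\<lambda>n. norm (f n))"
  shows "infsum f UNIV = suminf f"
  using norm_summable_imp_has_sum[OF assms summable_sums[OF summable_norm_cancel[OF assms]]]
  by (rule infsumI)

text \<open>The formal identity for the Cauchy square of the series passes to contractions because the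
  coefficients are absolutely summable.\<close>

lemma contraction_power_series_square:
  fixes B :: "'a::banach \<Rightarrow> 'a"
  assumes "bounded_linear B" and B: "\<And>x. norm (B x) \<le> norm x"
  defines "S \<equiv> \<lambda>x. \<Sum>k. sqrt_coeff k *\<^sub>R (B ^^ k) x"
  shows "S (S x) = x - B x"
proof -
  interpret B: bounded_linear B by fact
  have lin: "bounded_linear (B ^^ k)" for k
    by (induction k) (simp_all add: bounded_linear_ident id_def bounded_linear_compose
        B.bounded_linear_axioms comp_def)
  have bd: "norm ((B ^^ k) x) \<le> norm x" for k x
    by (induction k) (auto intro: order_trans[OF B])
  have sm: "summable (\<lambda>k. norm (sqrt_coeff k *\<^sub>R (B ^^ k) x))" for x
    by (rule summable_comparison_test'[OF summable_mult2[OF sqrt_coeff_summable, of "norm x"]])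
       (auto intro: mult_left_mono bd)
  define F where "F j k = (sqrt_coeff j * sqrt_coeff k) *\<^sub>R (B ^^ (j + k)) x" for j k
  have "(\<lambda>k. \<bar>sqrt_coeff k\<bar>) summable_on UNIV"
    using sqrt_coeff_summable by (intro norm_summable_imp_summable_on) simp
  then have "((\<lambda>k. \<bar>sqrt_coeff k\<bar>) has_sum infsum (\<lambda>k. \<bar>sqrt_coeff k\<bar>) UNIV) UNIV"
      (is "(_ has_sum ?c) _") and abs: "(\<lambda>k. \<bar>sqrt_coeff k\<bar>) summable_on UNIV"
    by simp_all
  then have "((\<lambda>k. \<bar>sqrt_coeff j\<bar> * \<bar>sqrt_coeff k\<bar>) has_sum (\<bar>sqrt_coeff j\<bar> * ?c)) UNIV" for j
    by (intro has_sum_cmult_right)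
  then have "(\<lambda>(j,k). \<bar>sqrt_coeff j\<bar> * \<bar>sqrt_coeff k\<bar>) summable_on UNIV \<times> UNIV"
    by (intro summable_on_SigmaI[where g = "\<lambda>j. \<bar>sqrt_coeff j\<bar> * ?c"] summable_on_cmult_left abs) auto
  then have "(\<lambda>p. (case p of (j,k) \<Rightarrow> \<bar>sqrt_coeff j\<bar> * \<bar>sqrt_coeff k\<bar>) * norm x) summable_on UNIV \<times> UNIV"
    by (rule summable_on_cmult_left)
  then have "(\<lambda>p. case p of (j,k) \<Rightarrow> F j k) abs_summable_on UNIV \<times> UNIV"
    by (rule Infinite_Sum.abs_summable_on_comparison_test')
       (auto simp: F_def abs_mult intro!: mult_left_mono bd)
  then have sF: "(\<lambda>(j,k). F j k) summable_on UNIV \<times> UNIV"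
    by (rule abs_summable_summable)
  have "S (S x) = (\<Sum>j. infsum (F j) UNIV)"
    unfolding S_def
  proof (rule suminf_cong)
    fix j
    interpret Bj: bounded_linear "B ^^ j" by (rule lin)
    have "sqrt_coeff j *\<^sub>R (B ^^ j) (\<Sum>k. sqrt_coeff k *\<^sub>R (B ^^ k) x) = (\<Sum>k. F j k)"
      using sm[of x, THEN summable_norm_cancel]
      by (simp add: F_def Bj.suminf[symmetric] suminf_scaleR_right[symmetric] Bj.scaleR
          Bj.summable funpow_add)
         (simp add: Bj.suminf Bj.scaleR[symmetric] suminf_scaleR_right Bj.summable)
    also have "\<dots> = infsum (F j) UNIV"
    proof (rule infsum_eq_suminf[symmetric])
      have "summable (\<lambda>k. (\<bar>sqrt_coeff j\<bar> * \<bar>sqrt_coeff k\<bar>) * norm x)"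
        using sqrt_coeff_summable by (intro summable_mult summable_mult2)
      then show "summable (\<lambda>k. norm (F j k))"
        by (rule summable_comparison_test') (auto simp: F_def abs_mult intro!: mult_left_mono bd)
    qed
    finally show "sqrt_coeff j *\<^sub>R (B ^^ j) (\<Sum>k. sqrt_coeff k *\<^sub>R (B ^^ k) x) = infsum (F j) UNIV" .
  qed
  also have "\<dots> = infsum (\<lambda>j. infsum (F j) UNIV) UNIV"
  proof (rule infsum_eq_suminf[symmetric])
    have "norm (infsum (F j) UNIV) \<le> \<bar>sqrt_coeff j\<bar> * (?c * norm x)" for j
    proof (rule norm_infsum_le)
      have "((\<lambda>k. \<bar>sqrt_coeff j\<bar> * \<bar>sqrt_coeff k\<bar> * norm x) has_sum (\<bar>sqrt_coeff j\<bar> * ?c * norm x)) UNIV"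
        using abs by (intro has_sum_cmult_right has_sum_cmult_left) simp
      then show "((\<lambda>k. \<bar>sqrt_coeff j\<bar> * \<bar>sqrt_coeff k\<bar> * norm x) has_sum (\<bar>sqrt_coeff j\<bar> * (?c * norm x))) UNIV"
        by (simp add: mult.assoc)
      show "(F j has_sum infsum (F j) UNIV) UNIV"
      proof -
        have "(\<lambda>k. \<bar>sqrt_coeff j\<bar> * \<bar>sqrt_coeff k\<bar> * norm x) summable_on UNIV"
          using abs by (intro summable_on_cmult_right summable_on_cmult_left)
        then have "F j abs_summable_on UNIV"
          by (rule Infinite_Sum.abs_summable_on_comparison_test')
             (auto simp: F_def abs_mult intro!: mult_left_mono bd)
        then show ?thesis by (rule has_sum_infsum[OF abs_summable_summable])
      qed
      show "norm (F j k) \<le> \<bar>sqrt_coeff j\<bar> * \<bar>sqrt_coeff k\<bar> * norm x" for k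
        by (auto simp: F_def abs_mult intro!: mult_left_mono bd)
    qed
    then show "summable (\<lambda>j. norm (infsum (F j) UNIV))"
      by (intro summable_comparison_test'[OF summable_mult2[OF sqrt_coeff_summable, of "?c * norm x"]])
         simp
  qed
  also have "\<dots> = infsum (\<lambda>(j,k). F j k) (UNIV \<times> UNIV)"
    using infsum_Sigma'_banach[OF sF] by simp
  \<comment> \<open>regroup the double series by the exponent \<open>n = j + k\<close>\<close>
  also have "\<dots> = infsum (\<lambda>(n,i). F i (n - i)) (Sigma UNIV (\<lambda>n. {..n}))"
    by (rule infsum_reindex_bij_witness[where j = "\<lambda>(j,k). (j + k, j)" and i = "\<lambda>(n,i). (i, n - i)"]) auto
  also have "\<dots> = infsum (\<lambda>n. infsum (\<lambda>i. F i (n - i)) {..n}) UNIV"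
  proof (rule infsum_Sigma'_banach[symmetric])
    show "(\<lambda>(n,i). F i (n - i)) summable_on Sigma UNIV (\<lambda>n. {..n})"
      using sF
      by (subst summable_on_reindex_bij_witness[where j = "\<lambda>(n,i). (i, n - i)" and i = "\<lambda>(j,k). (j + k, j)"
            and T = "UNIV \<times> UNIV" and h = "\<lambda>(j,k). F j k"]) auto
  qed
  also have "\<dots> = infsum (\<lambda>n. (if n = 0 then 1 else if n = 1 then -1 else 0) *\<^sub>R (B ^^ n) x) UNIV"
  proof (rule infsum_cong)
    fix n :: nat
    have "(\<Sum>i\<le>n. F i (n - i)) = (\<Sum>i\<le>n. sqrt_coeff i * sqrt_coeff (n - i)) *\<^sub>R (B ^^ n) x"
      unfolding scaleR_sum_left by (rule sum.cong) (auto simp: F_def)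
    then show "infsum (\<lambda>i. F i (n - i)) {..n} =
        (if n = 0 then 1 else if n = 1 then -1 else 0) *\<^sub>R (B ^^ n) x"
      by (simp only: sqrt_coeff_convolution infsum_finite finite_atMost)
  qed
  also have "\<dots> = infsum (\<lambda>n. (if n = 0 then 1 else if n = 1 then -1 else 0) *\<^sub>R (B ^^ n) x) {0, 1}"
    by (rule infsum_cong_neutral) auto
  also have "\<dots> = x - B x" by simp
  finally show ?thesis .
qed

text \<open>The square root of a positive contraction \<open>A\<close> is the binomial series of \<open>sqrt (1 - B)\<close> with
  \<open>B = I - A\<close>; being a limit of polynomials in \<open>A\<close>, it commutes with everything that commutes
  with \<open>A\<close>.\<close>

lemma positive_contraction_sqrt:
  fixes A :: "'a::chilbert_space \<Rightarrow> 'a"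
  assumes A: "positive_op A" and contr: "\<And>x. norm (A x) \<le> norm x"
  obtains S where "positive_op S" "S \<circ> S = A"
    "\<And>C. bounded_linear C \<Longrightarrow> C \<circ> A = A \<circ> C \<Longrightarrow> C \<circ> S = S \<circ> C"
proof -
  have linA: "bounded_linear A" and sym: "cinner (A x) y = cinner x (A y)" for x y
    using A by (auto simp: positive_op_iff intro: bounded_clinear_on_bounded_linear)
  have scA: "A (c *\<^sub>C x) = c *\<^sub>C A x" for c x
    using A by (simp add: positive_op_iff bounded_clinear_on_def)
  define B where "B x = x - A x" for x
  have linB: "bounded_linear B"
    unfolding B_def by (intro bounded_linear_sub bounded_linear_ident linA)
  have B: "norm (B x) \<le> norm x" for x
  proof -
    have "(norm (A x))\<^sup>2 \<le> Re (cinner x (A x))"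
      using positive_op_norm_le[OF A, of 1 x] contr by (simp add: sym)
    moreover have "(norm (B x))\<^sup>2 = (norm x)\<^sup>2 - 2 * Re (cinner x (A x)) + (norm (A x))\<^sup>2"
      using norm_add_square[of x "- A x"] by (simp add: B_def cinner.minus_right)
    ultimately have "(norm (B x))\<^sup>2 \<le> (norm x)\<^sup>2"
      using zero_le_power2[of "norm (A x)"] by linarith
    then show ?thesis by (rule power2_le_imp_le) simp
  qed
  have lin: "bounded_linear (B ^^ k)" for k
    by (induction k) (simp_all add: bounded_linear_ident id_def bounded_linear_compose linB comp_def)
  have bd: "norm ((B ^^ k) x) \<le> norm x" for k x
    by (induction k) (auto intro: order_trans[OF B])
  have symB: "cinner ((B ^^ k) x) y = cinner x ((B ^^ k) y)" for k x y
  proof (induction k arbitrary: x y)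
    case (Suc k)
    have "cinner ((B ^^ Suc k) x) y = cinner ((B ^^ k) x) (B y)"
      by (simp add: B_def cinner.diff_left cinner.diff_right sym)
    then show ?case by (simp add: Suc funpow_swap1)
  qed simp
  have scB: "(B ^^ k) (c *\<^sub>C x) = c *\<^sub>C (B ^^ k) x" for k c x
    by (induction k) (simp_all add: B_def scA linear_diff[OF bounded_linear.linear[OF scaleC_bounded_linear]])
  define S where "S x = (\<Sum>k. sqrt_coeff k *\<^sub>R (B ^^ k) x)" for x
  have smn: "summable (\<lambda>k. norm (sqrt_coeff k *\<^sub>R (B ^^ k) x))" for x
    by (rule summable_comparison_test'[OF summable_mult2[OF sqrt_coeff_summable, of "norm x"]])
       (auto intro: mult_left_mono bd)
  note sm = smn[THEN summable_norm_cancel]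
  have SS: "S (S x) = A x" for x
    using contraction_power_series_square[OF linB B, of x] unfolding S_def[abs_def]
    by (simp only: B_def[of x]) simp
  have add: "S (x + y) = S x + S y" for x y
    unfolding S_def by (simp add: suminf_add[OF sm sm] linear_add[OF bounded_linear.linear[OF lin]] scaleR_add_right)
  have comm: "C (S x) = S (C x)" if C: "bounded_linear C" and CA: "\<And>x. C (A x) = A (C x)" for C x
  proof -
    interpret C: bounded_linear C by (rule C)
    have "C ((B ^^ k) x) = (B ^^ k) (C x)" for k
      by (induction k) (simp_all add: B_def C.diff CA)
    then show ?thesis unfolding S_def by (simp add: C.suminf[OF sm] C.scaleR)
  qed
  have sc: "S (c *\<^sub>C x) = c *\<^sub>C S x" for c x
    using comm[OF scaleC_bounded_linear, of c x] scA by simp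
  have bdS: "norm (S x) \<le> (\<Sum>k. \<bar>sqrt_coeff k\<bar>) * norm x" for x
  proof -
    have "norm (S x) \<le> (\<Sum>k. \<bar>sqrt_coeff k\<bar> * norm x)"
      unfolding S_def by (intro order_trans[OF summable_norm[OF smn]] suminf_le smn
          summable_mult2[OF sqrt_coeff_summable]) (auto intro: mult_left_mono bd)
    then show ?thesis by (simp add: suminf_mult2[OF sqrt_coeff_summable])
  qed
  have in1: "cinner (S x) y = (\<Sum>k. sqrt_coeff k *\<^sub>R cinner ((B ^^ k) x) y)" for x y
    unfolding S_def
    by (subst bounded_linear.suminf[OF cinner.bounded_linear_left sm]) (simp add: cinner.scaleR_left)
  have in2: "cinner x (S y) = (\<Sum>k. sqrt_coeff k *\<^sub>R cinner x ((B ^^ k) y))" for x y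
    unfolding S_def
    by (subst bounded_linear.suminf[OF cinner.bounded_linear_right sm]) (simp add: cinner.scaleR_right)
  have symS: "cinner (S x) y = cinner x (S y)" for x y
    by (simp only: in1 in2 symB)
  have pos: "0 \<le> Re (cinner (S x) x)" for x
  proof -
    have "(\<lambda>n. \<Sum>k<n. sqrt_coeff k *\<^sub>R (B ^^ k) x) \<longlonglongrightarrow> S x"
      using summable_LIMSEQ[OF sm] by (simp add: S_def)
    then have "(\<lambda>n. Re (cinner (\<Sum>k<Suc n. sqrt_coeff k *\<^sub>R (B ^^ k) x) x)) \<longlonglongrightarrow> Re (cinner (S x) x)"
      by (intro tendsto_intros cinner.tendsto LIMSEQ_Suc)
    moreover have "0 \<le> Re (cinner (\<Sum>k<Suc n. sqrt_coeff k *\<^sub>R (B ^^ k) x) x)" for n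
    proof -
      \<comment> \<open>for \<open>k > 0\<close> the coefficient is not positive and \<open>\<langle>B\<^sup>k x, x\<rangle> \<le> \<parallel>x\<parallel>\<^sup>2\<close>\<close>
      have "sqrt_coeff k * (norm x)\<^sup>2 \<le> sqrt_coeff k * Re (cinner ((B ^^ k) x) x)" for k
      proof (cases k)
        case 0
        then show ?thesis by (simp add: Re_cinner_self)
      next
        case (Suc j)
        have "Re (cinner ((B ^^ k) x) x) \<le> norm ((B ^^ k) x) * norm x"
          using complex_Re_le_cmod cauchy_schwarz order_trans by blast
        also have "\<dots> \<le> (norm x)\<^sup>2"
          unfolding power2_eq_square by (intro mult_right_mono bd) simp
        finally show ?thesis
          using sqrt_coeff_nonpos[of j] Suc by (intro mult_left_mono_neg) auto
      qed
      then have "(\<Sum>k<Suc n. sqrt_coeff k * (norm x)\<^sup>2) \<le>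
          (\<Sum>k<Suc n. sqrt_coeff k * Re (cinner ((B ^^ k) x) x))"
        by (rule sum_mono)
      moreover have "0 \<le> (\<Sum>k<Suc n. sqrt_coeff k * (norm x)\<^sup>2)"
        using sqrt_coeff_sum_nonneg[of n]
        by (simp only: sum_distrib_right[symmetric] lessThan_Suc_atMost) simp
      ultimately show ?thesis by (simp add: cinner.sum_left cinner.scaleR_left del: sum.lessThan_Suc)
    qed
    ultimately show ?thesis by (intro LIMSEQ_le_const) auto
  qed
  have "bounded_clinear_on UNIV S"
    using add sc bdS unfolding bounded_clinear_on_def by blast
  then have "positive_op S" unfolding positive_op_iff using symS pos by blast
  moreover have "S \<circ> S = A" using SS by auto
  moreover have "C \<circ> S = S \<circ> C" if "bounded_linear C" "C \<circ> A = A \<circ> C" for C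
    using comm[OF that(1)] that(2) by (auto simp: fun_eq_iff)
  ultimately show ?thesis using that by blast
qed

lemma positive_op_scaleR:
  assumes "positive_op A" "r \<ge> 0"
  shows "positive_op (\<lambda>x. r *\<^sub>R A x)"
proof -
  obtain K where "\<And>x. norm (A x) \<le> K * norm x"
    using assms(1) by (auto simp: positive_op_iff bounded_clinear_on_def)
  then have bd: "norm (r *\<^sub>R A x) \<le> (r * K) * norm x" for x
    using assms(2) by (simp add: mult.assoc mult_left_mono)
  show ?thesis
    using assms exI[of "\<lambda>K. \<forall>x. norm (r *\<^sub>R A x) \<le> K * norm x", OF allI, OF bd]
    unfolding positive_op_iff bounded_clinear_on_def
    by (auto simp del: norm_scaleR simp: scaleR_add_right cinner.scaleR_left cinner.scaleR_right scaleR_scaleC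
        scaleC_scaleC mult.commute cinner_scaleC_left cinner_scaleC_right scaleC_add_right)
qed

text \<open>The general case is reduced to contractions by scaling.\<close>

lemma positive_sqrt_exists:
  fixes A :: "'a::chilbert_space \<Rightarrow> 'a"
  assumes A: "positive_op A"
  obtains S where "positive_op S" "S \<circ> S = A"
    "\<And>C. bounded_linear C \<Longrightarrow> C \<circ> A = A \<circ> C \<Longrightarrow> C \<circ> S = S \<circ> C"
proof -
  have "bounded_clinear_on UNIV A" using A by (simp add: positive_op_iff)
  then obtain c where c: "c > 0" "\<And>x. norm (A x) \<le> c * norm x"
    using bounded_clinear_on_bound by (metis UNIV_I)
  have contr: "norm ((1 / c) *\<^sub>R A x) \<le> norm x" for x
    using c by (simp add: field_simps)
  have "positive_op (\<lambda>x. (1 / c) *\<^sub>R A x)"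
    using A c by (intro positive_op_scaleR) auto
  then obtain S where S: "positive_op S" "S \<circ> S = (\<lambda>x. (1 / c) *\<^sub>R A x)"
    and comm: "\<And>C. bounded_linear C \<Longrightarrow> C \<circ> (\<lambda>x. (1 / c) *\<^sub>R A x) = (\<lambda>x. (1 / c) *\<^sub>R A x) \<circ> C \<Longrightarrow>
      C \<circ> S = S \<circ> C"
    using positive_contraction_sqrt[OF _ contr] by blast
  interpret S: bounded_linear S
    using S(1) by (auto simp: positive_op_iff intro: bounded_clinear_on_bounded_linear)
  have SS: "S (S x) = (1 / c) *\<^sub>R A x" for x
    using S(2) by (metis comp_apply)
  show ?thesis
  proof (rule that)
    show "positive_op (\<lambda>x. sqrt c *\<^sub>R S x)" using S(1) c(1) by (intro positive_op_scaleR) auto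
    show "(\<lambda>x. sqrt c *\<^sub>R S x) \<circ> (\<lambda>x. sqrt c *\<^sub>R S x) = A"
      using c(1) by (auto simp: S.scaleR SS)
    fix C :: "'a \<Rightarrow> 'a"
    assume C: "bounded_linear C" "C \<circ> A = A \<circ> C"
    then interpret C: bounded_linear C by simp
    have "C \<circ> S = S \<circ> C"
      using C(2) by (intro comm C(1)) (auto simp: fun_eq_iff C.scaleR)
    then show "C \<circ> (\<lambda>x. sqrt c *\<^sub>R S x) = (\<lambda>x. sqrt c *\<^sub>R S x) \<circ> C"
      by (auto simp: fun_eq_iff C.scaleR)
  qed
qed

text \<open>With \<open>y = S x - T x\<close>, commutation gives \<open>S y + T y = S\<^sup>2 x - T\<^sup>2 x = 0\<close>; by positivity \<open>S y = T y = 0\<close>,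
  and then \<open>\<parallel>y\<parallel>\<^sup>2 = \<langle>x, S y - T y\<rangle> = 0\<close>.\<close>

lemma positive_sqrt_unique:
  fixes S T :: "'a::chilbert_space \<Rightarrow> 'a"
  assumes S: "positive_op S" and T: "positive_op T"
    and sq: "S \<circ> S = T \<circ> T" and comm: "T \<circ> S = S \<circ> T"
  shows "S = T"
proof
  fix x
  interpret S: bounded_linear S
    using S by (auto simp: positive_op_iff intro: bounded_clinear_on_bounded_linear)
  interpret T: bounded_linear T
    using T by (auto simp: positive_op_iff intro: bounded_clinear_on_bounded_linear)
  have symS: "cinner (S x) y = cinner x (S y)" and symT: "cinner (T x) y = cinner x (T y)" for x y
    using S T by (auto simp: positive_op_iff)
  have sq': "S (S x) = T (T x)" and comm': "T (S x) = S (T x)" for x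
    using sq comm by (auto simp: fun_eq_iff)
  define y where "y = S x - T x"
  have "S y + T y = 0" by (simp add: y_def S.diff T.diff sq' comm')
  then have "Re (cinner (S y) y) + Re (cinner (T y) y) = 0"
    by (metis cinner_add_left cinner.zero_left plus_complex.sel(1) zero_complex.sel(1))
  moreover have "Re (cinner (S y) y) \<ge> 0" "Re (cinner (T y) y) \<ge> 0"
    using S T by (auto simp: positive_op_iff)
  ultimately have "S y = 0" "T y = 0"
    by (intro positive_op_eq_zero S T; linarith)+
  have "cinner y y = cinner x (S y) - cinner x (T y)"
    by (simp add: symS[symmetric] symT[symmetric] cinner.diff_left[symmetric] y_def[symmetric])
  then have "y = 0" using \<open>S y = 0\<close> \<open>T y = 0\<close> by (simp add: cinner_self)
  then show "S x = T x" by (simp add: y_def)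
qed

text \<open>The definite description in \<^const>\<open>sqrt_op\<close> is justified: any positive square root of \<open>A\<close> commutes
  with \<open>A\<close>, hence with the constructed one, and so equals it.\<close>

lemma sqrt_op:
  fixes A :: "'a::chilbert_space \<Rightarrow> 'a"
  assumes A: "positive_op A"
  shows "positive_op (sqrt_op A)" "sqrt_op A (sqrt_op A x) = A x"
proof -
  obtain S where S: "positive_op S" "S \<circ> S = A"
    and comm: "\<And>C. bounded_linear C \<Longrightarrow> C \<circ> A = A \<circ> C \<Longrightarrow> C \<circ> S = S \<circ> C"
    using positive_sqrt_exists[OF A] by blast
  have uniq: "T = S" if T: "positive_op T \<and> T \<circ> T = A" for T
  proof -
    have "bounded_linear T"
      using T by (auto simp: positive_op_iff intro: bounded_clinear_on_bounded_linear)
    then have "T \<circ> S = S \<circ> T" using T by (intro comm) (auto simp: comp_assoc)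
    then show ?thesis using positive_sqrt_unique[of S T] S T by simp
  qed
  have *: "positive_op (sqrt_op A) \<and> sqrt_op A \<circ> sqrt_op A = A"
    unfolding sqrt_op_def by (rule theI[of _ S]) (use S uniq in blast)+
  then show "positive_op (sqrt_op A)" by blast
  show "sqrt_op A (sqrt_op A x) = A x" using * by (metis comp_apply)
qed

lemma norm_sqrt_op:
  assumes "positive_op A"
  shows "(norm (sqrt_op A x))\<^sup>2 = Re (cinner (A x) x)"
proof -
  have "cinner (sqrt_op A x) (sqrt_op A x) = cinner (A x) x"
    using sqrt_op[OF assms] unfolding positive_op_iff by metis
  then show ?thesis by (metis Re_cinner_self)
qed

section \<open>Extension of contractions to the closure of a range\<close>

lemma closed_csubspace_closure_range:
  assumes S: "bounded_clinear_on UNIV S"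
  shows "closed_csubspace (closure (range S))"
  unfolding closed_csubspace_def
proof (intro conjI ballI allI)
  have "S 0 = 0" using bounded_clinear_on_zero[OF closed_csubspace_UNIV S] .
  then show "0 \<in> closure (range S)" by (metis closure_subset rangeI subsetD)
next
  fix x y assume "x \<in> closure (range S)" "y \<in> closure (range S)"
  then obtain a b where "\<And>n. a n \<in> range S" "a \<longlonglongrightarrow> x" "\<And>n. b n \<in> range S" "b \<longlonglongrightarrow> y"
    unfolding closure_sequential by blast
  moreover have "u + v \<in> range S" if "u \<in> range S" "v \<in> range S" for u v
    using that bounded_clinear_onD(1)[OF S] by (metis (no_types) UNIV_I image_iff)
  ultimately show "x + y \<in> closure (range S)"
    unfolding closure_sequential by (intro exI[of _ "\<lambda>n. a n + b n"]) (simp add: tendsto_add)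
next
  fix c x assume "x \<in> closure (range S)"
  then obtain a where "\<And>n. a n \<in> range S" "a \<longlonglongrightarrow> x"
    unfolding closure_sequential by blast
  moreover have "c *\<^sub>C u \<in> range S" if "u \<in> range S" for u
    using that bounded_clinear_onD(2)[OF S] by (metis (no_types) UNIV_I image_iff)
  ultimately show "c *\<^sub>C x \<in> closure (range S)"
    unfolding closure_sequential
    by (intro exI[of _ "\<lambda>n. c *\<^sub>C a n"])
       (simp add: bounded_linear.tendsto[OF scaleC_bounded_linear])
qed simp

text \<open>If \<open>\<parallel>T h\<parallel> \<le> \<parallel>S h\<parallel>\<close> for all \<open>h\<close>, then \<open>S h \<mapsto> T h\<close> is a well-defined contraction on the range
  of \<open>S\<close> and extends to the closure by uniform continuity.\<close>

lemma ex1_contraction_on_closure_range: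
  fixes S :: "'a::chilbert_space \<Rightarrow> 'b::chilbert_space" and T :: "'a \<Rightarrow> 'c::chilbert_space"
  assumes S: "bounded_clinear_on UNIV S" and T: "bounded_clinear_on UNIV T"
    and le: "\<And>h. norm (T h) \<le> norm (S h)"
  shows "\<exists>!C. C \<in> bounded_ops (closure (range S)) (closure (range T)) \<and>
    (\<forall>x\<in>closure (range S). norm (C x) \<le> norm x) \<and> (\<forall>h. C (S h) = T h)"
proof -
  define M where "M = closure (range S)"
  have M: "closed_csubspace M" unfolding M_def by (rule closed_csubspace_closure_range[OF S])
  interpret S: bounded_linear S by (rule bounded_clinear_on_bounded_linear[OF S])
  interpret T: bounded_linear T by (rule bounded_clinear_on_bounded_linear[OF T])
  have scS: "S (c *\<^sub>C x) = c *\<^sub>C S x" and scT: "T (c *\<^sub>C x) = c *\<^sub>C T x" for c x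
    using S T by (auto simp: bounded_clinear_on_def)
  have le_diff: "norm (T h - T k) \<le> norm (S h - S k)" for h k
    using le[of "h - k"] by (simp add: S.diff T.diff)
  \<comment> \<open>by \<open>le_diff\<close>, \<open>f y\<close> does not depend on the choice of the preimage\<close>
  define f where "f y = T (SOME h. S h = y)" for y
  have f: "f (S h) = T h" for h
  proof -
    have "S (SOME k. S k = S h) = S h" by (rule someI) simp
    then show ?thesis using le_diff[of "SOME k. S k = S h" h] by (simp add: f_def)
  qed
  have "uniformly_continuous_on (range S) f"
  proof (rule lipschitz_on_uniformly_continuous)
    show "1-lipschitz_on (range S) f"
      unfolding lipschitz_on_def dist_norm using le_diff by (auto simp: f)
  qed
  then obtain g where g: "uniformly_continuous_on M g" "\<And>x. x \<in> range S \<Longrightarrow> f x = g x"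
    unfolding M_def by (rule uniformly_continuous_on_extension_on_closure) blast
  have gS: "g (S h) = T h" for h using g(2)[of "S h"] f by simp
  have SM: "S h \<in> M" for h using closure_subset[of "range S"] by (auto simp: M_def)
  have approx: "\<exists>s. (\<lambda>n. S (s n)) \<longlonglongrightarrow> x" if "x \<in> M" for x
  proof -
    obtain a where a: "\<And>n. a n \<in> range S" "a \<longlonglongrightarrow> x"
      using \<open>x \<in> M\<close> unfolding M_def closure_sequential by blast
    then have "\<forall>n. \<exists>h. a n = S h" by blast
    then obtain s where "\<And>n. a n = S (s n)" by metis
    then have "a = (\<lambda>n. S (s n))" by blast
    then show ?thesis using a(2) by blast
  qed
  have lim: "(\<lambda>n. T (s n)) \<longlonglongrightarrow> g x" if "(\<lambda>n. S (s n)) \<longlonglongrightarrow> x" "x \<in> M" for s x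
    using continuous_on_tendsto_compose[OF uniformly_continuous_imp_continuous[OF g(1)] that]
    by (simp add: SM gS)
  have add: "g (x + y) = g x + g y" if xy: "x \<in> M" "y \<in> M" for x y
  proof -
    obtain s t where st: "(\<lambda>n. S (s n)) \<longlonglongrightarrow> x" "(\<lambda>n. S (t n)) \<longlonglongrightarrow> y"
      using approx xy by blast
    have "(\<lambda>n. T (s n + t n)) \<longlonglongrightarrow> g (x + y)"
      using tendsto_add[OF st] by (intro lim closed_csubspaceD(3)[OF M] xy) (simp add: S.add)
    moreover have "(\<lambda>n. T (s n + t n)) \<longlonglongrightarrow> g x + g y"
      unfolding T.add using lim st xy by (intro tendsto_add)
    ultimately show ?thesis by (rule LIMSEQ_unique)
  qed
  have scale: "g (c *\<^sub>C x) = c *\<^sub>C g x" if x: "x \<in> M" for c x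
  proof -
    obtain s where s: "(\<lambda>n. S (s n)) \<longlonglongrightarrow> x"
      using approx x by blast
    have "(\<lambda>n. T (c *\<^sub>C s n)) \<longlonglongrightarrow> g (c *\<^sub>C x)"
      using bounded_linear.tendsto[OF scaleC_bounded_linear s]
      by (intro lim closed_csubspaceD(4)[OF M] x) (simp add: scS)
    moreover have "(\<lambda>n. T (c *\<^sub>C s n)) \<longlonglongrightarrow> c *\<^sub>C g x"
      unfolding scT using lim[OF s x] by (rule bounded_linear.tendsto[OF scaleC_bounded_linear])
    ultimately show ?thesis by (rule LIMSEQ_unique)
  qed
  have contr: "norm (g x) \<le> norm x" if x: "x \<in> M" for x
  proof -
    obtain s where s: "(\<lambda>n. S (s n)) \<longlonglongrightarrow> x"
      using approx x by blast
    then show ?thesis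
      using le by (intro LIMSEQ_le[OF tendsto_norm[OF lim[OF s x]] tendsto_norm[OF s]]) auto
  qed
  have range: "g x \<in> closure (range T)" if x: "x \<in> M" for x
  proof -
    obtain s where s: "(\<lambda>n. S (s n)) \<longlonglongrightarrow> x"
      using approx x by blast
    then show ?thesis
      unfolding closure_sequential using lim[OF s x] by (intro exI[of _ "\<lambda>n. T (s n)"]) simp
  qed
  have unique: "C = restrict g M"
    if C: "C \<in> bounded_ops M (closure (range T))" "\<forall>h. C (S h) = T h" for C
  proof (rule extensionalityI[of _ M])
    show "C \<in> extensional M" using C(1) by (auto simp: bounded_ops_iff PiE_def)
    fix x assume x: "x \<in> M"
    obtain s where s: "(\<lambda>n. S (s n)) \<longlonglongrightarrow> x"
      using approx x by blast
    have "continuous_on M C"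
      using C(1) by (intro bounded_clinear_on_continuous[OF M]) (simp add: bounded_ops_iff)
    from continuous_on_tendsto_compose[OF this s x] have "(\<lambda>n. T (s n)) \<longlonglongrightarrow> C x"
      by (simp add: SM C(2))
    then show "C x = restrict g M x" using lim[OF s x] x by (auto intro: LIMSEQ_unique)
  qed simp
  have "bounded_clinear_on M (restrict g M)"
    unfolding bounded_clinear_on_def
  proof (intro conjI ballI allI exI)
    show "norm (restrict g M x) \<le> 1 * norm x" if "x \<in> M" for x using contr that by simp
  qed (simp_all add: add scale closed_csubspaceD[OF M])
  then have "restrict g M \<in> bounded_ops M (closure (range T))"
    using range by (auto simp: bounded_ops_iff)
  then show ?thesis
    unfolding M_def[symmetric]
    by (intro ex1I[of _ "restrict g M"] conjI) (auto simp: contr SM gS unique)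
qed

section \<open>Words and cylinder sets\<close>

lemma nwords_iff: "w \<in> nwords m n \<longleftrightarrow> w \<in> words m \<and> length w = n"
  by (simp add: nwords_def)

lemma append_in_words [simp]: "w @ [j] \<in> words m \<longleftrightarrow> w \<in> words m \<and> j < m"
  by (auto simp: words_def)

lemma finite_nwords [simp]: "finite (nwords m n)"
proof -
  have "nwords m n = {w. set w \<subseteq> {..<m} \<and> length w = n}"
    by (auto simp: nwords_def words_def)
  then show ?thesis by (simp add: finite_lists_length_eq)
qed

lemma nwords_Suc_split:
  assumes "v \<in> nwords m (Suc n)"
  shows "butlast v \<in> nwords m n" "last v < m" "butlast v @ [last v] = v"
proof -
  have "v \<noteq> []" using assms by (auto simp: nwords_iff)
  then show eq: "butlast v @ [last v] = v" by simp
  with assms have "butlast v @ [last v] \<in> words m" by (simp add: nwords_iff)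
  then show "butlast v \<in> nwords m n" "last v < m" using assms by (auto simp: nwords_iff)
qed

lemma sum_nwords_Suc: "(\<Sum>v\<in>nwords m (Suc n). f v) = (\<Sum>w\<in>nwords m n. \<Sum>j<m. f (w @ [j]))"
proof -
  have "(\<Sum>w\<in>nwords m n. \<Sum>j<m. f (w @ [j])) = (\<Sum>(w,j)\<in>nwords m n \<times> {..<m}. f (w @ [j]))"
    by (rule sum.cartesian_product)
  also have "\<dots> = (\<Sum>v\<in>nwords m (Suc n). f v)"
  proof (rule sum.reindex_bij_witness[where i = "\<lambda>v. (butlast v, last v)" and j = "\<lambda>(w,j). w @ [j]"])
    fix v assume v: "v \<in> nwords m (Suc n)"
    note v' = nwords_Suc_split[OF v]
    show "(butlast v, last v) \<in> nwords m n \<times> {..<m}" using v' by simp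
    show "(case (butlast v, last v) of (w,j) \<Rightarrow> w @ [j]) = v" using v'(3) by simp
  qed (auto simp: nwords_iff)
  finally show ?thesis by simp
qed

lemma space_Omega: "space (Omega m) = {x. \<forall>i. x i < m}"
  by (auto simp: Omega_def space_PiM PiE_def)

lemma cyl_measurable:
  assumes "w \<in> words m"
  shows "cyl m w \<in> sets (Omega m)"
proof -
  have "{x \<in> space (Omega m). x i = w ! i} \<in> sets (Omega m)" if "i < length w" for i
  proof -
    have "w ! i < m" using assms that by (auto simp: words_def)
    then have "(\<lambda>x. x i) -` {w ! i} \<inter> space (Omega m) \<in> sets (Omega m)"
      unfolding Omega_def by (intro measurable_sets[OF measurable_component_singleton]) auto
    then show ?thesis by (simp add: vimage_def Int_def conj_commute)
  qed
  then have "{x \<in> space (Omega m). \<forall>i\<in>{..<length w}. x i = w ! i} \<in> sets (Omega m)"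
    by (intro sets.sets_Collect_finite_All) auto
  moreover have "cyl m w = {x \<in> space (Omega m). \<forall>i\<in>{..<length w}. x i = w ! i}"
    by (auto simp: cyl_def)
  ultimately show ?thesis by simp
qed

lemma cyl_append: "cyl m (w @ [j]) = {x \<in> cyl m w. x (length w) = j}"
  by (auto simp: cyl_def nth_append less_Suc_eq)

lemma cyl_Int_cyl: "length w \<le> length v \<Longrightarrow> cyl m w \<inter> cyl m v = (if prefix w v then cyl m v else {})"
proof -
  assume le: "length w \<le> length v"
  have "prefix w v \<longleftrightarrow> (\<forall>i<length w. w ! i = v ! i)"
  proof
    assume "prefix w v"
    then show "\<forall>i<length w. w ! i = v ! i" by (auto simp: prefix_def nth_append)
  next
    assume "\<forall>i<length w. w ! i = v ! i"
    then have "take (length w) v = w" using le by (intro nth_equalityI) auto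
    then show "prefix w v" by (metis take_is_prefix)
  qed
  then show ?thesis using le by (auto simp: cyl_def)
qed

text \<open>The empty set is added so that the generator is closed under intersections.\<close>

lemma sets_Omega_cyl: "sets (Omega m) = sigma_sets (space (Omega m)) (insert {} (cyl m ` words m))"
proof
  let ?G = "insert {} (cyl m ` words m)" and ?\<Omega> = "space (Omega m)"
  interpret sigma_algebra ?\<Omega> "sigma_sets ?\<Omega> ?G"
    by (rule sigma_algebra_sigma_sets) (auto simp: cyl_def)
  show "sigma_sets ?\<Omega> ?G \<subseteq> sets (Omega m)"
    by (rule sets.sigma_sets_subset) (auto simp: cyl_measurable)
  have "{x \<in> ?\<Omega>. x i \<in> A} \<in> sigma_sets ?\<Omega> ?G" for i A
  proof -
    have "{x \<in> ?\<Omega>. x i \<in> A} = (\<Union>w\<in>{w\<in>nwords m (Suc i). w ! i \<in> A}. cyl m w)"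
    proof (intro equalityI subsetI)
      fix x assume x: "x \<in> {x \<in> ?\<Omega>. x i \<in> A}"
      then have "map x [0..<Suc i] \<in> {w\<in>nwords m (Suc i). w ! i \<in> A}"
        by (auto simp: nwords_iff words_def space_Omega nth_append)
      moreover have "x \<in> cyl m (map x [0..<Suc i])"
        using x by (simp add: cyl_def nth_append less_Suc_eq)
      ultimately show "x \<in> (\<Union>w\<in>{w\<in>nwords m (Suc i). w ! i \<in> A}. cyl m w)" by blast
    qed (auto simp: cyl_def nwords_iff)
    moreover have "cyl m w \<in> sigma_sets ?\<Omega> ?G" if "w \<in> nwords m (Suc i)" for w
      using that by (intro sigma_sets.Basic) (auto simp: nwords_iff)
    ultimately show ?thesis by (auto intro!: finite_UN)
  qed
  then have "{{f \<in> (\<Pi>\<^sub>E i\<in>UNIV. space (count_space {..<m})). f i \<in> A} |i A. i \<in> UNIV \<and>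
      A \<in> sets (count_space {..<m})} \<subseteq> sigma_sets ?\<Omega> ?G"
    by (auto simp: Omega_def space_PiM)
  then show "sets (Omega m) \<subseteq> sigma_sets ?\<Omega> ?G"
    unfolding Omega_def sets_PiM_single space_PiM by (rule sigma_sets_mono)
qed

section \<open>Positive operator valued measures\<close>

lemma povm_positive: "povm m E \<Longrightarrow> B \<in> sets (Omega m) \<Longrightarrow> positive_op (E B)"
  by (simp add: povm_def)

lemma povm_sums:
  assumes "povm m E" "range A \<subseteq> sets (Omega m)" "disjoint_family A"
  shows "(\<lambda>i. cinner (E (A i) x) y) sums cinner (E (\<Union>i. A i) x) y"
  using assms by (auto simp: povm_def)

text \<open>Countable additivity along the constant sequence \<open>{}\<close> forces the value \<open>0\<close>.\<close>

lemma povm_empty: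
  assumes "povm m E"
  shows "E {} x = 0"
proof -
  have "(\<lambda>i::nat. cinner (E {} x) y) sums cinner (E {} x) y" for y
    using povm_sums[OF assms, of "\<lambda>_. {}"] by (simp add: disjoint_family_on_def)
  then have "cinner (E {} x) (E {} x) = 0"
    using sums_summable summable_const_iff by blast
  then show ?thesis by (simp add: cinner_self)
qed

lemma povm_finite_additive:
  assumes E: "povm m E" and A: "\<And>j. j < k \<Longrightarrow> A j \<in> sets (Omega m)"
    and disj: "disjoint_family_on A {..<k::nat}"
  shows "cinner (E (\<Union>j<k. A j) x) y = (\<Sum>j<k. cinner (E (A j) x) y)"
proof -
  define B where "B j = (if j < k then A j else {})" for j
  have "(\<lambda>i. cinner (E (B i) x) y) sums cinner (E (\<Union>i. B i) x) y"
    using A disj by (intro povm_sums[OF E]) (auto simp: B_def disjoint_family_on_def)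
  moreover have "(\<Union>i. B i) = (\<Union>j<k. A j)" by (auto simp: B_def)
  moreover have "(\<lambda>i. cinner (E (B i) x) y) sums (\<Sum>j<k. cinner (E (B j) x) y)"
    by (rule sums_finite) (auto simp: B_def povm_empty[OF E] cinner.zero_left)
  ultimately show ?thesis by (simp add: sums_unique2[of "\<lambda>i. cinner (E (B i) x) y"] B_def)
qed

lemma povm_cyl:
  assumes E: "povm m E" and w: "w \<in> words m"
  shows "cinner (E (cyl m w) x) y = (\<Sum>j<m. cinner (E (cyl m (w @ [j])) x) y)"
proof -
  have "cyl m w = (\<Union>j<m. cyl m (w @ [j]))"
    by (auto simp: cyl_append) (auto simp: cyl_def space_Omega)
  then have "cinner (E (cyl m w) x) y = cinner (E (\<Union>j<m. cyl m (w @ [j])) x) y" by simp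
  also have "\<dots> = (\<Sum>j<m. cinner (E (cyl m (w @ [j])) x) y)"
  proof (rule povm_finite_additive[OF E])
    show "cyl m (w @ [j]) \<in> sets (Omega m)" if "j < m" for j
      using w that by (intro cyl_measurable) simp
  qed (auto simp: disjoint_family_on_def cyl_append)
  finally show ?thesis .
qed

text \<open>The measurable sets \<open>B\<close> for which \<open>P B\<close> commutes with \<open>T\<close> form a \<open>\<lambda>\<close>-system by weak additivity, and
  the cylinders form a \<open>\<pi>\<close>-system that generates the measurable sets.\<close>

lemma povm_commute_cyl:
  assumes P: "povm m P" and T: "selfadjoint_on UNIV T"
    and cyl: "\<And>w x. w \<in> words m \<Longrightarrow> T (P (cyl m w) x) = P (cyl m w) (T x)"
    and B: "B \<in> sets (Omega m)"
  shows "T (P B x) = P B (T x)"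
proof -
  let ?\<Omega> = "space (Omega m)" and ?G = "insert {} (cyl m ` words m)"
  have T0: "T 0 = 0" and symT: "cinner (T x) y = cinner x (T y)" for x y
    using T bounded_clinear_on_zero[OF closed_csubspace_UNIV] by (auto simp: selfadjoint_on_UNIV_iff)
  have weakI: "T (P B x) = P B (T x)" if "\<And>x y. cinner (P B x) (T y) = cinner (P B (T x)) y" for B x
  proof (rule csubspace_cinner_ext[OF closed_csubspace_UNIV UNIV_I UNIV_I])
    fix z
    have "cinner (T (P B x)) z = cinner (P B (T x)) z" using that by (simp add: symT)
    then show "cinner z (T (P B x)) = cinner z (P B (T x))" by (metis cinner_commute)
  qed
  have weakD: "cinner (P B x) (T y) = cinner (P B (T x)) y" if "\<And>x. T (P B x) = P B (T x)" for B x y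
    using that by (simp add: symT[symmetric])
  have stable: "Int_stable ?G"
    unfolding Int_stable_def
  proof (intro ballI)
    fix a b assume "a \<in> ?G" "b \<in> ?G"
    then consider "a = {} \<or> b = {}" | w v where "a = cyl m w" "b = cyl m v" "w \<in> words m" "v \<in> words m"
      by auto
    then show "a \<inter> b \<in> ?G"
    proof cases
      case 2
      then show ?thesis
        using cyl_Int_cyl[of w v m] cyl_Int_cyl[of v w m] nat_le_linear[of "length w" "length v"]
        by (auto simp: Int_commute split: if_splits)
    qed auto
  qed
  have sub: "?G \<subseteq> Pow ?\<Omega>" by (auto simp: cyl_def)
  have "B \<in> sigma_sets ?\<Omega> ?G" using B by (simp only: sets_Omega_cyl)
  from stable sub this have "\<forall>x. T (P B x) = P B (T x)"
  proof (induction B rule: sigma_sets_induct_disjoint)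
    case (basic A)
    then show ?case using cyl by (auto simp: povm_empty[OF P] T0)
  next
    case empty
    show ?case by (simp add: povm_empty[OF P] T0)
  next
    case (compl A)
    then have A: "A \<in> sets (Omega m)" by (simp only: sets_Omega_cyl)
    have "cinner (P (?\<Omega> - A) x) y = cinner x y - cinner (P A x) y" for x y
    proof -
      define C where "C j = (if j = (0::nat) then A else ?\<Omega> - A)" for j
      have "cinner (P (\<Union>j<2. C j) x) y = (\<Sum>j<2. cinner (P (C j) x) y)"
        using A by (intro povm_finite_additive[OF P]) (auto simp: C_def disjoint_family_on_def)
      moreover have "(\<Union>j<2. C j) = ?\<Omega>"
        using sets.sets_into_space[OF A] by (auto simp: C_def numeral_2_eq_2 lessThan_Suc)
      moreover have "P ?\<Omega> = id" using P by (simp add: povm_def)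
      ultimately show ?thesis by (simp add: C_def numeral_2_eq_2)
    qed
    then show ?case using weakD[of A] compl by (intro allI weakI) (simp add: symT)
  next
    case (union A)
    then have A: "range A \<subseteq> sets (Omega m)" by (simp only: sets_Omega_cyl)
    have "cinner (P (\<Union>i. A i) x) (T y) = cinner (P (\<Union>i. A i) (T x)) y" for x y
    proof (rule sums_unique2)
      show "(\<lambda>i. cinner (P (A i) x) (T y)) sums cinner (P (\<Union>i. A i) x) (T y)"
        using A union(1) by (rule povm_sums[OF P])
      have "(\<lambda>i. cinner (P (A i) (T x)) y) sums cinner (P (\<Union>i. A i) (T x)) y"
        using A union(1) by (rule povm_sums[OF P])
      then show "(\<lambda>i. cinner (P (A i) x) (T y)) sums cinner (P (\<Union>i. A i) (T x)) y"
        using union(3) by (simp add: weakD)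
    qed
    then show ?case by (intro allI weakI)
  qed
  then show ?thesis by blast
qed

section \<open>The edge contractions\<close>

lemma rsqrt_bounded_clinear:
  assumes "povm m E" "w \<in> words m"
  shows "bounded_clinear_on UNIV (rsqrt m E w)"
  using sqrt_op(1)[OF povm_positive[OF assms(1) cyl_measurable[OF assms(2)]]]
  by (simp add: rsqrt_def positive_op_iff)

lemma closed_csubspace_rspace:
  assumes "povm m E" "w \<in> words m"
  shows "closed_csubspace (rspace m E w)"
  unfolding rspace_def by (intro closed_csubspace_closure_range rsqrt_bounded_clinear assms)

text \<open>\<open>\<parallel>rsqrt m E w h\<parallel>\<^sup>2 = \<langle>E (cyl m w) h, h\<rangle>\<close> is the sum of the corresponding values over the children of
  \<open>w\<close>.\<close>

lemma norm_rsqrt_append_le: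
  assumes E: "povm m E" and w: "w \<in> words m" and j: "j < m"
  shows "norm (rsqrt m E (w @ [j]) h) \<le> norm (rsqrt m E w h)"
proof -
  have norm: "(norm (rsqrt m E v h))\<^sup>2 = Re (cinner (E (cyl m v) h) h)" if "v \<in> words m" for v
    using norm_sqrt_op[OF povm_positive[OF E cyl_measurable[OF that]]] by (simp add: rsqrt_def)
  have "(norm (rsqrt m E w h))\<^sup>2 = (\<Sum>i<m. (norm (rsqrt m E (w @ [i]) h))\<^sup>2)"
    using w by (simp add: norm povm_cyl[OF E w])
  then have "(norm (rsqrt m E (w @ [j]) h))\<^sup>2 \<le> (norm (rsqrt m E w h))\<^sup>2"
    using member_le_sum[of j "{..<m}" "\<lambda>i. (norm (rsqrt m E (w @ [i]) h))\<^sup>2"] j by simp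
  then show ?thesis by (rule power2_le_imp_le) simp
qed

lemma edge_bounded_ops:
  assumes E: "povm m E" and w: "w \<in> words m" and j: "j < m"
  shows "edge m E w j \<in> bounded_ops (rspace m E w) (rspace m E (w @ [j]))"
proof -
  have "\<exists>!C. C \<in> bounded_ops (rspace m E w) (rspace m E (w @ [j])) \<and>
      (\<forall>x\<in>rspace m E w. norm (C x) \<le> norm x) \<and> (\<forall>h. C (rsqrt m E w h) = rsqrt m E (w @ [j]) h)"
    unfolding rspace_def using w j
    by (intro ex1_contraction_on_closure_range rsqrt_bounded_clinear[OF E] norm_rsqrt_append_le[OF E]) auto
  from theI'[OF this] show ?thesis unfolding edge_def by blast
qed

section \<open>The range space dilation\<close>

text \<open>The isometries \<open>U n\<close> and the projection-valued measure \<open>P\<close> of a range space dilation of \<open>E\<close>.\<close>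

locale range_dilation =
  fixes m :: nat
    and E :: "(nat \<Rightarrow> nat) set \<Rightarrow> 'h::chilbert_space \<Rightarrow> 'h"
    and U :: "nat \<Rightarrow> (nat list \<Rightarrow> 'h) \<Rightarrow> 'k::chilbert_space"
    and P :: "(nat \<Rightarrow> nat) set \<Rightarrow> 'k \<Rightarrow> 'k"
  assumes E: "povm m E"
    and dl: "direct_limit m E U"
    and P: "pvm m P"
    and P_U: "\<And>w n x. w \<in> words m \<Longrightarrow> length w \<le> n \<Longrightarrow> x \<in> Kspace m E n \<Longrightarrow>
      P (cyl m w) (U n x) = U n (Kproj w x)"
begin

abbreviation R :: "nat list \<Rightarrow> 'h set"
  where "R \<equiv> rspace m E"

text \<open>The vector of the direct sum with the single entry \<open>x\<close> at the word \<open>w\<close>.\<close>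

definition single :: "nat list \<Rightarrow> 'h \<Rightarrow> nat list \<Rightarrow> 'h"
  where "single w x = (\<lambda>u. if u = w then x else 0)"

text \<open>The isometric embedding of the summand \<open>R w\<close> into the dilation space, and its adjoint.\<close>

definition emb :: "nat list \<Rightarrow> 'h \<Rightarrow> 'k"
  where "emb w x = U (length w) (single w x)"

definition coemb :: "nat list \<Rightarrow> 'k \<Rightarrow> 'h"
  where "coemb w = adj_on (R w) cinner cinner (emb w)"

lemma closed_csubspace_R: "w \<in> words m \<Longrightarrow> closed_csubspace (R w)"
  by (rule closed_csubspace_rspace[OF E])

lemma edge_clinear: "w \<in> words m \<Longrightarrow> j < m \<Longrightarrow> bounded_clinear_on (R w) (edge m E w j)"
  and edge_in: "w \<in> words m \<Longrightarrow> j < m \<Longrightarrow> x \<in> R w \<Longrightarrow> edge m E w j x \<in> R (w @ [j])"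
  using edge_bounded_ops[OF E] by (auto simp: bounded_ops_iff)

lemma edge_adj:
  assumes "w \<in> words m" "j < m"
  shows "edge_adj m E w j y \<in> R w"
    and "x \<in> R w \<Longrightarrow> cinner (edge m E w j x) y = cinner x (edge_adj m E w j y)"
  using adj_on_cinner[OF closed_csubspace_R[OF assms(1)] edge_clinear[OF assms]] by (auto simp: edge_adj_def)

lemma U_add: "x \<in> Kspace m E n \<Longrightarrow> y \<in> Kspace m E n \<Longrightarrow> U n (\<lambda>w. x w + y w) = U n x + U n y"
  and U_scaleC: "x \<in> Kspace m E n \<Longrightarrow> U n (\<lambda>w. c *\<^sub>C x w) = c *\<^sub>C U n x"
  and U_norm: "x \<in> Kspace m E n \<Longrightarrow> norm (U n x) = L2_set (\<lambda>w. norm (x w)) (nwords m n)"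
  and U_J: "x \<in> Kspace m E n \<Longrightarrow> U (Suc n) (Jmap m E n x) = U n x"
  and U_dense: "closure (\<Union>n. U n ` Kspace m E n) = UNIV"
  using dl by (auto simp: direct_limit_def Kisometry_def)

lemma Kspace_add: "x \<in> Kspace m E n \<Longrightarrow> y \<in> Kspace m E n \<Longrightarrow> (\<lambda>w. x w + y w) \<in> Kspace m E n"
  by (auto simp: Kspace_def nwords_iff intro: closed_csubspaceD(3)[OF closed_csubspace_R])

lemma Kspace_scaleC: "x \<in> Kspace m E n \<Longrightarrow> (\<lambda>w. c *\<^sub>C x w) \<in> Kspace m E n"
  by (auto simp: Kspace_def nwords_iff intro: closed_csubspaceD(4)[OF closed_csubspace_R])

lemma Kspace_zero: "(\<lambda>_. 0) \<in> Kspace m E n"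
  by (auto simp: Kspace_def nwords_iff intro: closed_csubspaceD(2)[OF closed_csubspace_R])

lemma U_zero: "U n (\<lambda>_. 0) = 0"
  using U_norm[OF Kspace_zero, of n] by (simp add: L2_set_def)

text \<open>By polarization the maps \<open>U n\<close> preserve inner products.\<close>

lemma U_cinner:
  assumes x: "x \<in> Kspace m E n" and y: "y \<in> Kspace m E n"
  shows "cinner (U n x) (U n y) = Kinner m n x y"
proof -
  have sq: "(norm (U n z))\<^sup>2 = (\<Sum>w\<in>nwords m n. (norm (z w))\<^sup>2)" if "z \<in> Kspace m E n" for z
    by (simp add: U_norm[OF that] L2_set_def sum_nonneg)
  have Re: "Re (cinner (U n z) (U n y)) = Re (Kinner m n z y)" if z: "z \<in> Kspace m E n" for z
  proof -
    have "(norm (U n z + U n y))\<^sup>2 = (\<Sum>w\<in>nwords m n. (norm (z w + y w))\<^sup>2)"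
      using sq[OF Kspace_add[OF z y]] by (simp add: U_add[OF z y])
    then show ?thesis
      unfolding norm_add_square Kinner_def
      by (simp add: sum.distrib sq z y sum_distrib_left[symmetric])
  qed
  have "Re (\<i> * cinner (U n x) (U n y)) = Re (\<i> * Kinner m n x y)"
    using Re[OF Kspace_scaleC[OF x, of \<i>]]
    by (simp add: U_scaleC[OF x] cinner_scaleC_left Kinner_def sum_distrib_left)
  then show ?thesis using Re[OF x] by (simp add: complex_eq_iff)
qed

lemma single_in_Kspace: "w \<in> nwords m n \<Longrightarrow> x \<in> R w \<Longrightarrow> single w x \<in> Kspace m E n"
  by (auto simp: Kspace_def single_def nwords_iff intro: closed_csubspaceD(2)[OF closed_csubspace_R])

lemma emb_zero: "emb w 0 = 0"
  by (simp add: emb_def single_def U_zero)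

lemma emb_cinner:
  assumes "w \<in> nwords m n" "v \<in> nwords m n" "x \<in> R w" "y \<in> R v"
  shows "cinner (emb w x) (emb v y) = (if w = v then cinner x y else 0)"
proof -
  have "cinner (emb w x) (emb v y) = Kinner m n (single w x) (single v y)"
    using U_cinner[OF single_in_Kspace single_in_Kspace, OF assms(1,3,2,4)] assms(1,2)
    by (simp add: emb_def nwords_iff)
  also have "\<dots> = (\<Sum>u\<in>nwords m n. if u = w then cinner x (if w = v then y else 0) else 0)"
    unfolding Kinner_def by (rule sum.cong) (auto simp: single_def cinner.zero_left)
  also have "\<dots> = (if w = v then cinner x y else 0)"
    using assms(1) by (simp add: sum.delta' cinner.zero_right)
  finally show ?thesis .
qed

lemma emb_norm:
  assumes "w \<in> words m" "x \<in> R w"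
  shows "norm (emb w x) = norm x"
proof -
  have "cinner (emb w x) (emb w x) = cinner x x"
    using emb_cinner[of w "length w" w x x] assms by (simp add: nwords_iff)
  then show ?thesis by (simp add: cinner_self power2_eq_iff_nonneg del: of_real_power)
qed

lemma emb_clinear:
  assumes w: "w \<in> words m"
  shows "bounded_clinear_on (R w) (emb w)"
proof -
  have n: "w \<in> nwords m (length w)" using w by (simp add: nwords_iff)
  have "emb w (x + y) = emb w x + emb w y" if "x \<in> R w" "y \<in> R w" for x y
  proof -
    have "single w (x + y) = (\<lambda>u. single w x u + single w y u)" by (auto simp: single_def)
    then show ?thesis using U_add[OF single_in_Kspace single_in_Kspace, OF n _ n] that
      by (simp add: emb_def)
  qed
  moreover have "emb w (c *\<^sub>C x) = c *\<^sub>C emb w x" if "x \<in> R w" for c x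
  proof -
    have "single w (c *\<^sub>C x) = (\<lambda>u. c *\<^sub>C single w x u)" by (auto simp: single_def)
    then show ?thesis using U_scaleC[OF single_in_Kspace, OF n] that by (simp add: emb_def)
  qed
  moreover have "norm (emb w x) \<le> 1 * norm x" if "x \<in> R w" for x
    using emb_norm[OF w that] by simp
  ultimately show ?thesis unfolding bounded_clinear_on_def by blast
qed

lemma coemb:
  assumes "w \<in> words m"
  shows "coemb w y \<in> R w" and "x \<in> R w \<Longrightarrow> cinner (emb w x) y = cinner x (coemb w y)"
    and "bounded_clinear_on UNIV (coemb w)"
  using adj_on_cinner[OF closed_csubspace_R emb_clinear, OF assms assms]
    adj_on_bounded_clinear[OF closed_csubspace_R emb_clinear, OF assms assms]
  by (auto simp: coemb_def)

lemma cinner_coemb: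
  assumes "w \<in> words m" "x \<in> R w"
  shows "cinner y (emb w x) = cinner (coemb w y) x"
  using coemb(2)[OF assms, of y] by (metis cinner_commute)

text \<open>By induction on the set of coordinates, since \<open>U n\<close> is only known to be additive for two summands.\<close>

lemma U_eq_sum:
  assumes x: "x \<in> Kspace m E n"
  shows "U n x = (\<Sum>w\<in>nwords m n. emb w (x w))"
proof -
  have "(\<lambda>u. if u \<in> F then x u else 0) \<in> Kspace m E n \<and>
      U n (\<lambda>u. if u \<in> F then x u else 0) = (\<Sum>w\<in>F. emb w (x w))"
    if "finite F" "F \<subseteq> nwords m n" for F
    using that
  proof (induction F rule: finite_induct)
    case empty
    show ?case by (simp add: Kspace_zero U_zero)
  next
    case (insert w F)
    have eq: "(\<lambda>u. if u \<in> insert w F then x u else 0) =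
        (\<lambda>u. single w (x w) u + (if u \<in> F then x u else 0))"
      using insert(2) by (auto simp: single_def)
    have s: "single w (x w) \<in> Kspace m E n"
      using insert(4) x by (intro single_in_Kspace) (auto simp: Kspace_def)
    show ?case
      unfolding eq using insert Kspace_add[OF s] U_add[OF s]
      by (auto simp: emb_def nwords_iff)
  qed
  from this[of "nwords m n"] have "U n (\<lambda>u. if u \<in> nwords m n then x u else 0) = (\<Sum>w\<in>nwords m n. emb w (x w))"
    by simp
  moreover have "(\<lambda>u. if u \<in> nwords m n then x u else 0) = x"
    using x by (auto simp: Kspace_def)
  ultimately show ?thesis by simp
qed

text \<open>The range of \<open>U n\<close>, described as a set of sums of embedded vectors.  These subspaces increase with \<open>n\<close>
  and have a dense union.\<close>

definition level_space :: "nat \<Rightarrow> 'k set"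
  where "level_space n = {\<Sum>w\<in>nwords m n. emb w (f w) |f. \<forall>w\<in>nwords m n. f w \<in> R w}"

lemma level_space_eq: "level_space n = U n ` Kspace m E n"
proof (intro equalityI subsetI)
  fix a assume "a \<in> level_space n"
  then obtain f where f: "\<forall>w\<in>nwords m n. f w \<in> R w" "a = (\<Sum>w\<in>nwords m n. emb w (f w))"
    by (auto simp: level_space_def)
  define x where "x = (\<lambda>w. if w \<in> nwords m n then f w else 0)"
  have "x \<in> Kspace m E n" using f(1) by (simp add: Kspace_def x_def)
  moreover from U_eq_sum[OF this] have "a = U n x" by (simp add: f(2) x_def)
  ultimately show "a \<in> U n ` Kspace m E n" by blast
qed (auto simp: level_space_def Kspace_def U_eq_sum)

lemma level_space_dense: "closure (\<Union>n. level_space n) = UNIV"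
  by (simp add: level_space_eq U_dense)

lemma emb_in_level_space: "w \<in> nwords m n \<Longrightarrow> x \<in> R w \<Longrightarrow> emb w x \<in> level_space n"
  using single_in_Kspace[of w n x] by (auto simp: level_space_eq emb_def nwords_iff)

text \<open>The compatibility of \<open>U n\<close> and \<open>U (Suc n)\<close> with the connecting map, read at a single word.\<close>

lemma emb_eq_sum_edge:
  assumes w: "w \<in> words m" and x: "x \<in> R w"
  shows "emb w x = (\<Sum>j<m. emb (w @ [j]) (edge m E w j x))"
proof -
  let ?n = "length w"
  let ?J = "Jmap m E ?n (single w x)"
  have n: "w \<in> nwords m ?n" using w by (simp add: nwords_iff)
  have edge0: "edge m E v j 0 = 0" if "v \<in> words m" "j < m" for v j
    using bounded_clinear_on_zero[OF closed_csubspace_R edge_clinear] that by auto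
  have J: "?J (v @ [j]) = (if v = w then edge m E w j x else 0)" if "v \<in> nwords m ?n" "j < m" for v j
    using that edge0 by (auto simp: Jmap_def single_def nwords_iff)
  have "?J \<in> Kspace m E (Suc ?n)"
    unfolding Kspace_def
  proof (intro CollectI conjI ballI allI impI)
    fix v assume v: "v \<in> nwords m (Suc ?n)"
    note v' = nwords_Suc_split[OF v]
    have "(if butlast v = w then edge m E w (last v) x else 0) \<in> R (butlast v @ [last v])"
      using edge_in[OF w v'(2) x] closed_csubspaceD(2)[OF closed_csubspace_R] v'(1,2) by (auto simp: nwords_iff)
    then show "?J v \<in> R v" using J[OF v'(1,2)] unfolding v'(3) by simp
  qed (simp add: Jmap_def)
  then have "U (Suc ?n) ?J = (\<Sum>v\<in>nwords m ?n. \<Sum>j<m. emb (v @ [j]) (?J (v @ [j])))"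
    by (simp add: U_eq_sum sum_nwords_Suc)
  also have "\<dots> = (\<Sum>v\<in>nwords m ?n. if v = w then (\<Sum>j<m. emb (w @ [j]) (edge m E w j x)) else 0)"
    by (intro sum.cong refl) (auto simp: J emb_zero intro!: sum.cong)
  also have "\<dots> = (\<Sum>j<m. emb (w @ [j]) (edge m E w j x))"
    using n by (simp add: sum.delta')
  finally show ?thesis using U_J[OF single_in_Kspace[OF n x]] by (simp add: emb_def)
qed

lemma level_space_Suc: "level_space n \<subseteq> level_space (Suc n)"
proof
  fix a assume "a \<in> level_space n"
  then obtain f where f: "\<forall>w\<in>nwords m n. f w \<in> R w" "a = (\<Sum>w\<in>nwords m n. emb w (f w))"
    by (auto simp: level_space_def)
  define g where "g v = edge m E (butlast v) (last v) (f (butlast v))" for v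
  have "a = (\<Sum>v\<in>nwords m (Suc n). emb v (g v))"
    unfolding f(2) sum_nwords_Suc
    using f(1) by (intro sum.cong refl) (simp add: emb_eq_sum_edge g_def nwords_iff)
  moreover have "g v \<in> R v" if v: "v \<in> nwords m (Suc n)" for v
  proof -
    note v' = nwords_Suc_split[OF v]
    have "edge m E (butlast v) (last v) (f (butlast v)) \<in> R (butlast v @ [last v])"
      using v'(1,2) f(1) by (intro edge_in) (auto simp: nwords_iff)
    then show ?thesis unfolding v'(3) by (simp add: g_def)
  qed
  ultimately show "a \<in> level_space (Suc n)" unfolding level_space_def by blast
qed

lemma level_space_mono: "n \<le> k \<Longrightarrow> level_space n \<subseteq> level_space k"
  by (rule lift_Suc_mono_le[of level_space]) (rule level_space_Suc)

lemma coemb_sum: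
  assumes f: "\<forall>w\<in>nwords m n. f w \<in> R w" and v: "v \<in> nwords m n"
  shows "coemb v (\<Sum>w\<in>nwords m n. emb w (f w)) = f v"
proof (rule csubspace_cinner_ext[OF closed_csubspace_R])
  have v': "v \<in> words m" using v by (simp add: nwords_iff)
  then show "v \<in> words m" "coemb v (\<Sum>w\<in>nwords m n. emb w (f w)) \<in> R v" "f v \<in> R v"
    using f v coemb by auto
  fix z assume z: "z \<in> R v"
  have "cinner z (coemb v (\<Sum>w\<in>nwords m n. emb w (f w))) = (\<Sum>w\<in>nwords m n. cinner (emb v z) (emb w (f w)))"
    by (simp only: coemb(2)[OF v' z, symmetric] cinner.sum_right)
  also have "\<dots> = (\<Sum>w\<in>nwords m n. if w = v then cinner z (f v) else 0)"
    using f v z by (intro sum.cong refl) (auto simp: emb_cinner[of _ n])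
  finally show "cinner z (coemb v (\<Sum>w\<in>nwords m n. emb w (f w))) = cinner z (f v)"
    using v by (simp add: sum.delta')
qed

lemma level_space_eq_sum_coemb:
  assumes "a \<in> level_space n"
  shows "a = (\<Sum>w\<in>nwords m n. emb w (coemb w a))"
proof -
  obtain f where f: "\<forall>w\<in>nwords m n. f w \<in> R w" "a = (\<Sum>w\<in>nwords m n. emb w (f w))"
    using assms by (auto simp: level_space_def)
  then show ?thesis using coemb_sum[OF f(1)] by simp
qed

lemma coemb_append:
  assumes a: "a \<in> level_space n" and w: "w \<in> nwords m n" and j: "j < m"
  shows "coemb (w @ [j]) a = edge m E w j (coemb w a)"
proof -
  define g where "g v = edge m E (butlast v) (last v) (coemb (butlast v) a)" for v
  have "a = (\<Sum>v\<in>nwords m (Suc n). emb v (g v))"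
    unfolding sum_nwords_Suc
    by (subst level_space_eq_sum_coemb[OF a], intro sum.cong refl)
       (simp add: emb_eq_sum_edge g_def nwords_iff coemb(1))
  moreover have "\<forall>v\<in>nwords m (Suc n). g v \<in> R v"
  proof
    fix v assume v: "v \<in> nwords m (Suc n)"
    note v' = nwords_Suc_split[OF v]
    have "edge m E (butlast v) (last v) (coemb (butlast v) a) \<in> R (butlast v @ [last v])"
      using v'(1,2) by (intro edge_in coemb(1)) (auto simp: nwords_iff)
    then show "g v \<in> R v" unfolding v'(3) by (simp add: g_def)
  qed
  ultimately have "coemb (w @ [j]) a = g (w @ [j])"
    using coemb_sum[of "Suc n" g "w @ [j]"] w j by (simp add: nwords_iff)
  then show ?thesis by (simp add: g_def)
qed

lemma norm_sum_emb:
  assumes f: "\<forall>w\<in>nwords m n. f w \<in> R w"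
  shows "(norm (\<Sum>w\<in>nwords m n. emb w (f w)))\<^sup>2 = (\<Sum>w\<in>nwords m n. (norm (f w))\<^sup>2)"
proof -
  let ?s = "\<Sum>w\<in>nwords m n. emb w (f w)"
  have "cinner ?s ?s = (\<Sum>w\<in>nwords m n. cinner (f w) (coemb w ?s))"
    using f by (subst cinner.sum_left) (intro sum.cong refl, auto simp: coemb(2) nwords_iff)
  also have "\<dots> = (\<Sum>w\<in>nwords m n. cinner (f w) (f w))"
    using coemb_sum[OF f] by simp
  finally have "Re (cinner ?s ?s) = (\<Sum>w\<in>nwords m n. Re (cinner (f w) (f w)))" by simp
  then show ?thesis by (simp only: Re_cinner_self)
qed

text \<open>The left-hand side is \<open>\<parallel>p\<parallel>\<^sup>2 = \<langle>p, y\<rangle>\<close> for the projection \<open>p\<close> of \<open>y\<close> to the range of \<open>U n\<close>.\<close>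

lemma bessel: "(\<Sum>w\<in>nwords m n. (norm (coemb w y))\<^sup>2) \<le> (norm y)\<^sup>2"
proof -
  define p where "p = (\<Sum>w\<in>nwords m n. emb w (coemb w y))"
  have p: "(norm p)\<^sup>2 = (\<Sum>w\<in>nwords m n. (norm (coemb w y))\<^sup>2)"
    unfolding p_def by (rule norm_sum_emb) (simp add: coemb(1) nwords_iff)
  have "cinner p y = (\<Sum>w\<in>nwords m n. cinner (coemb w y) (coemb w y))"
    unfolding p_def by (subst cinner.sum_left) (intro sum.cong refl, simp add: coemb nwords_iff)
  then have "Re (cinner p y) = (norm p)\<^sup>2" by (simp add: p Re_cinner_self)
  then have "norm p * norm p \<le> norm y * norm p"
    using complex_Re_le_cmod[of "cinner p y"] cauchy_schwarz[of p y]
    by (simp add: power2_eq_square mult.commute)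
  then have "norm p \<le> norm y" by (cases "p = 0") (auto dest: mult_right_le_imp_le)
  then show ?thesis by (simp add: p[symmetric] power_mono)
qed

text \<open>The adjoint of \<open>U n\<close> exists and acts summand by summand, so only functionals on the spaces \<open>R w\<close> have
  to be represented.\<close>

lemma U_adj_eq: "U_adj m E U n y = (\<lambda>w. if w \<in> nwords m n then coemb w y else 0)"
  (is "_ = ?x")
  unfolding U_adj_def adj_on_def
proof (rule the_equality)
  have x: "?x \<in> Kspace m E n" by (auto simp: Kspace_def coemb(1) nwords_iff)
  have inner: "cinner (U n z) y = (\<Sum>w\<in>nwords m n. cinner (z w) (coemb w y))"
    if "z \<in> Kspace m E n" for z
    using that unfolding U_eq_sum[OF that] cinner.sum_left
    by (intro sum.cong refl) (auto simp: coemb Kspace_def nwords_iff)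
  then show "?x \<in> Kspace m E n \<and> (\<forall>z\<in>Kspace m E n. cinner (U n z) y = Kinner m n z ?x)"
    using x by (simp add: Kinner_def)
  fix x assume x: "x \<in> Kspace m E n \<and> (\<forall>z\<in>Kspace m E n. cinner (U n z) y = Kinner m n z x)"
  show "x = ?x"
  proof
    fix w
    show "x w = ?x w"
    proof (cases "w \<in> nwords m n")
      case True
      have "x w = coemb w y"
      proof (rule csubspace_cinner_ext[OF closed_csubspace_R])
        show "w \<in> words m" "x w \<in> R w" "coemb w y \<in> R w"
          using True x by (auto simp: nwords_iff coemb(1) Kspace_def)
        fix z assume z: "z \<in> R w"
        have K: "Kinner m n (single w z) u = cinner z (u w)" for u
        proof -
          have "Kinner m n (single w z) u = (\<Sum>v\<in>nwords m n. if v = w then cinner z (u w) else 0)"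
            unfolding Kinner_def by (rule sum.cong) (auto simp: single_def cinner.zero_left)
          then show ?thesis using True by (simp add: sum.delta')
        qed
        have "cinner (U n (single w z)) y = cinner z (x w)"
          using x single_in_Kspace[OF True z] by (simp add: K)
        moreover have "cinner (emb w z) y = cinner z (coemb w y)"
          using True z by (simp add: coemb nwords_iff)
        ultimately show "cinner z (x w) = cinner z (coemb w y)"
          using True by (simp add: emb_def nwords_iff)
      qed
      then show ?thesis using True by simp
    qed (use x in \<open>auto simp: Kspace_def\<close>)
  qed
qed

lemma P_emb:
  assumes "w \<in> words m" "v \<in> words m" "length w \<le> length v" "x \<in> R v"
  shows "P (cyl m w) (emb v x) = (if prefix w v then emb v x else 0)"
proof -
  have "v \<in> nwords m (length v)" using assms(2) by (simp add: nwords_iff)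
  then have "P (cyl m w) (emb v x) = U (length v) (Kproj w (single v x))"
    unfolding emb_def using assms by (intro P_U single_in_Kspace) auto
  also have "Kproj w (single v x) = (if prefix w v then single v x else (\<lambda>_. 0))"
    by (auto simp: Kproj_def single_def)
  finally show ?thesis by (simp add: emb_def U_zero)
qed

lemma P_povm: "povm m P"
  using P by (simp add: pvm_def)

lemma P_cinner: "w \<in> words m \<Longrightarrow> cinner (P (cyl m w) x) y = cinner x (P (cyl m w) y)"
  using povm_positive[OF P_povm cyl_measurable] by (auto simp: positive_op_iff)

lemma coemb_P:
  assumes w: "w \<in> words m" and v: "v \<in> words m" and "length w \<le> length v"
  shows "coemb v (P (cyl m w) y) = (if prefix w v then coemb v y else 0)"
proof (rule csubspace_cinner_ext[OF closed_csubspace_R[OF v]])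
  fix z assume z: "z \<in> R v"
  show "cinner z (coemb v (P (cyl m w) y)) = cinner z (if prefix w v then coemb v y else 0)"
    using P_emb[OF assms z] P_cinner[OF w, of "emb v z" y]
    by (auto simp: coemb(2)[OF v z, symmetric] cinner.zero_left cinner.zero_right)
qed (use coemb(1)[OF v] closed_csubspaceD(2)[OF closed_csubspace_R[OF v]] in auto)

section \<open>Compression of commuting operators\<close>

text \<open>The family of diagonal blocks of \<open>T\<close>, restricted to words and to the spaces \<open>R w\<close> so that it can be
  equal to a martingale, which is \<open>undefined\<close> elsewhere.\<close>

definition compress :: "('k \<Rightarrow> 'k) \<Rightarrow> nat list \<Rightarrow> 'h \<Rightarrow> 'h"
  where "compress T = (\<lambda>w\<in>words m. \<lambda>x\<in>R w. coemb w (T (emb w x)))"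

lemma compress_apply: "w \<in> words m \<Longrightarrow> x \<in> R w \<Longrightarrow> compress T w x = coemb w (T (emb w x))"
  by (simp add: compress_def)

lemma commutantD:
  assumes "T \<in> commutant_sa m P"
  shows "bounded_clinear_on UNIV T" "cinner (T x) y = cinner x (T y)"
    "w \<in> words m \<Longrightarrow> T (P (cyl m w) x) = P (cyl m w) (T x)"
  using assms cyl_measurable by (auto simp: commutant_sa_def selfadjoint_on_UNIV_iff fun_eq_iff)

text \<open>\<open>P (cyl m w)\<close> fixes \<open>emb w x\<close>, annihilates \<open>emb v y\<close>, and can be moved past \<open>T\<close>.\<close>

lemma commutant_offdiag:
  assumes T: "T \<in> commutant_sa m P" and w: "w \<in> nwords m n" and v: "v \<in> nwords m n" and "w \<noteq> v"
    and x: "x \<in> R w" and y: "y \<in> R v"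
  shows "cinner (emb w x) (T (emb v y)) = 0"
proof -
  have w': "w \<in> words m" "length w \<le> length v" and v': "v \<in> words m"
    using w v by (auto simp: nwords_iff)
  have "\<not> prefix w v" using w v \<open>w \<noteq> v\<close> by (auto simp: nwords_iff prefix_def)
  then have "P (cyl m w) (emb v y) = 0" using P_emb[OF w'(1) v' w'(2) y] by simp
  moreover have "P (cyl m w) (emb w x) = emb w x" using P_emb[OF w'(1) w'(1) _ x] by simp
  ultimately show ?thesis
    using P_cinner[OF w'(1), of "emb w x" "T (emb v y)"] commutantD(3)[OF T w'(1), of "emb v y"]
      bounded_clinear_on_zero[OF closed_csubspace_UNIV commutantD(1)[OF T]]
    by (simp add: cinner.zero_right)
qed

lemma commutant_block_diagonal:
  assumes T: "T \<in> commutant_sa m P" and x: "x \<in> Kspace m E n"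
  shows "U_adj m E U n (T (U n x)) = Kdiag m n (compress T) x"
proof
  fix v
  show "U_adj m E U n (T (U n x)) v = Kdiag m n (compress T) x v"
  proof (cases "v \<in> nwords m n")
    case True
    then have v: "v \<in> words m" and xR: "\<And>w. w \<in> nwords m n \<Longrightarrow> x w \<in> R w"
      using x by (auto simp: nwords_iff Kspace_def)
    have "coemb v (T (U n x)) = coemb v (T (emb v (x v)))"
    proof (rule csubspace_cinner_ext[OF closed_csubspace_R[OF v] coemb(1)[OF v] coemb(1)[OF v]])
      fix z assume z: "z \<in> R v"
      have "T (U n x) = (\<Sum>w\<in>nwords m n. T (emb w (x w)))"
        unfolding U_eq_sum[OF x]
        by (rule bounded_clinear_on_sum_distrib[OF closed_csubspace_UNIV commutantD(1)[OF T]]) simp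
      then have "cinner (emb v z) (T (U n x)) = (\<Sum>w\<in>nwords m n. cinner (emb v z) (T (emb w (x w))))"
        by (simp add: cinner.sum_right)
      also have "\<dots> = (\<Sum>w\<in>nwords m n. if w = v then cinner (emb v z) (T (emb v (x v))) else 0)"
        using commutant_offdiag[OF T True _ _ z xR] by (intro sum.cong refl) auto
      also have "\<dots> = cinner (emb v z) (T (emb v (x v)))"
        using True by (simp add: sum.delta')
      finally show "cinner z (coemb v (T (U n x))) = cinner z (coemb v (T (emb v (x v))))"
        by (simp add: coemb(2)[OF v z])
    qed
    then show ?thesis
      using True xR[OF True] by (simp add: U_adj_eq Kdiag_def compress_apply v)
  qed (simp add: U_adj_eq Kdiag_def)
qed

lemma compress_martingale:
  assumes T: "T \<in> commutant_sa m P"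
  shows "bounded_range_martingale m E (compress T)"
proof -
  note linT = commutantD(1)[OF T] and symT = commutantD(2)[OF T]
  obtain K where K: "K > 0" "\<And>x. norm (T x) \<le> K * norm x"
    using bounded_clinear_on_bound[OF linT] by auto
  have lin: "bounded_clinear_on (R w) (\<lambda>x. coemb w (T (emb w x)))" if "w \<in> words m" for w
    using bounded_clinear_on_compose[OF emb_clinear[OF that] _
        bounded_clinear_on_compose[OF linT _ coemb(3)[OF that]]] by simp
  have bound: "norm (compress T w x) \<le> K * norm x" if w: "w \<in> words m" and x: "x \<in> R w" for w x
  proof -
    have "norm (compress T w x) \<le> 1 * norm (T (emb w x))"
      unfolding compress_apply[OF w x] coemb_def
      using emb_norm[OF w] by (intro adj_on_norm_le[OF closed_csubspace_R[OF w] emb_clinear[OF w]]) simp_all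
    then show ?thesis using K(2)[of "emb w x"] emb_norm[OF w x] by simp
  qed
  show ?thesis
    unfolding bounded_range_martingale_def
  proof (intro conjI ballI)
    show "compress T \<in> extensional (words m)" by (simp add: compress_def)
  next
    fix w assume w: "w \<in> words m"
    have "bounded_clinear_on (R w) (compress T w)"
      using lin[OF w] closed_csubspaceD[OF closed_csubspace_R[OF w]]
      by (auto simp: bounded_clinear_on_def compress_apply w)
    moreover have "compress T w \<in> R w \<rightarrow>\<^sub>E R w"
      using w by (auto simp: compress_def coemb(1))
    moreover have "cinner (compress T w x) y = cinner x (compress T w y)" if "x \<in> R w" "y \<in> R w" for x y
      using that w by (simp add: compress_apply coemb(2)[symmetric] cinner_coemb[symmetric] symT)
    ultimately show "selfadjoint_on (R w) (compress T w)"
      by (simp add: selfadjoint_on_def bounded_ops_iff)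
  next
    show "bdd_above ((\<lambda>w. onorm_on (R w) (compress T w)) ` words m)"
    proof (rule bdd_aboveI2)
      fix w assume w: "w \<in> words m"
      have "norm (compress T w x) / norm x \<le> K" if "x \<in> R w" for x
        using bound[OF w that] K(1) by (cases "x = 0") (simp_all add: divide_le_eq)
      then show "onorm_on (R w) (compress T w) \<le> K"
        unfolding onorm_on_def using closed_csubspaceD(2)[OF closed_csubspace_R[OF w]] by (intro cSUP_least) auto
    qed
  next
    fix w x assume w: "w \<in> words m" and x: "x \<in> R w"
    let ?e = "edge m E w"
    have wj: "w @ [j] \<in> nwords m (Suc (length w))" "w @ [j] \<in> words m" if "j < m" for j
      using w that by (auto simp: nwords_iff)
    show "compress T w x = (\<Sum>j<m. edge_adj m E w j (compress T (w @ [j]) (?e j x)))"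
    proof (rule csubspace_cinner_ext[OF closed_csubspace_R[OF w]])
      show "compress T w x \<in> R w" by (simp add: compress_apply w x coemb(1))
      show "(\<Sum>j<m. edge_adj m E w j (compress T (w @ [j]) (?e j x))) \<in> R w"
        using w by (intro closed_csubspace_sum[OF closed_csubspace_R[OF w]] edge_adj(1)) auto
      fix z assume z: "z \<in> R w"
      have "T (emb w x) = (\<Sum>k<m. T (emb (w @ [k]) (?e k x)))"
        unfolding emb_eq_sum_edge[OF w x]
        by (rule bounded_clinear_on_sum_distrib[OF closed_csubspace_UNIV linT]) simp
      then have "cinner z (compress T w x) =
          cinner (\<Sum>j<m. emb (w @ [j]) (?e j z)) (\<Sum>k<m. T (emb (w @ [k]) (?e k x)))"
        by (simp only: compress_apply w x coemb(2)[OF w z, symmetric] emb_eq_sum_edge[OF w z])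
      also have "\<dots> = (\<Sum>j<m. \<Sum>k<m. cinner (emb (w @ [j]) (?e j z)) (T (emb (w @ [k]) (?e k x))))"
        by (simp only: cinner.sum_left) (simp only: cinner.sum_right)
      also have "\<dots> = (\<Sum>j<m. \<Sum>k<m. if k = j then
          cinner (emb (w @ [j]) (?e j z)) (T (emb (w @ [j]) (?e j x))) else 0)"
        using commutant_offdiag[OF T wj(1) wj(1)] edge_in[OF w _ z] edge_in[OF w _ x]
        by (intro sum.cong refl) auto
      also have "\<dots> = (\<Sum>j<m. cinner (emb (w @ [j]) (?e j z)) (T (emb (w @ [j]) (?e j x))))"
        by (simp add: sum.delta')
      also have "\<dots> = (\<Sum>j<m. cinner z (edge_adj m E w j (compress T (w @ [j]) (?e j x))))"
      proof (rule sum.cong[OF refl])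
        fix j assume "j \<in> {..<m}"
        then have j: "j < m" by simp
        show "cinner (emb (w @ [j]) (?e j z)) (T (emb (w @ [j]) (?e j x))) =
            cinner z (edge_adj m E w j (compress T (w @ [j]) (?e j x)))"
          by (simp add: compress_apply[OF wj(2)[OF j] edge_in[OF w j x]]
              coemb(2)[OF wj(2)[OF j] edge_in[OF w j z]] edge_adj(2)[OF w j z])
      qed
      finally show "cinner z (compress T w x) =
          cinner z (\<Sum>j<m. edge_adj m E w j (compress T (w @ [j]) (?e j x)))"
        by (simp add: cinner.sum_right)
    qed
  qed
qed

lemma martingaleD:
  assumes "bounded_range_martingale m E X" "w \<in> words m"
  shows "bounded_clinear_on (R w) (X w)" "x \<in> R w \<Longrightarrow> X w x \<in> R w"
    "x \<in> R w \<Longrightarrow> y \<in> R w \<Longrightarrow> cinner (X w x) y = cinner x (X w y)"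
    "x \<in> R w \<Longrightarrow> X w x = (\<Sum>j<m. edge_adj m E w j (X (w @ [j]) (edge m E w j x)))"
    "X w \<in> extensional (R w)"
proof -
  have sa: "selfadjoint_on (R w) (X w)" and
    mart: "\<forall>x\<in>R w. X w x = (\<Sum>j<m. edge_adj m E w j (X (w @ [j]) (edge m E w j x)))"
    using assms unfolding bounded_range_martingale_def by blast+
  show "bounded_clinear_on (R w) (X w)" "x \<in> R w \<Longrightarrow> X w x \<in> R w"
    "x \<in> R w \<Longrightarrow> y \<in> R w \<Longrightarrow> cinner (X w x) y = cinner x (X w y)"
    "X w \<in> extensional (R w)"
    using sa by (auto simp: selfadjoint_on_def bounded_ops_iff PiE_def)
  show "x \<in> R w \<Longrightarrow> X w x = (\<Sum>j<m. edge_adj m E w j (X (w @ [j]) (edge m E w j x)))"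
    using mart by blast
qed

lemma compress_eqI:
  assumes X: "bounded_range_martingale m E X"
    and eq: "\<And>w x. w \<in> words m \<Longrightarrow> x \<in> R w \<Longrightarrow> coemb w (T (emb w x)) = X w x"
  shows "compress T = X"
proof (rule extensionalityI[of _ "words m"])
  show "compress T \<in> extensional (words m)" by (simp add: compress_def)
  show "X \<in> extensional (words m)" using X by (simp add: bounded_range_martingale_def)
  fix w assume w: "w \<in> words m"
  show "compress T w = X w"
    using martingaleD(5)[OF X w] eq[OF w] w
    by (intro extensionalityI[of _ "R w"]) (auto simp: compress_def)
qed

lemma compress_eq_iff:
  assumes T: "T \<in> commutant_sa m P" and X: "bounded_range_martingale m E X"
  shows "compress T = X \<longleftrightarrow>
    (\<forall>n. \<forall>x\<in>Kspace m E n. U_adj m E U n (T (U n x)) = Kdiag m n X x)"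
proof
  assume "compress T = X"
  then show "\<forall>n. \<forall>x\<in>Kspace m E n. U_adj m E U n (T (U n x)) = Kdiag m n X x"
    using commutant_block_diagonal[OF T] by auto
next
  assume *: "\<forall>n. \<forall>x\<in>Kspace m E n. U_adj m E U n (T (U n x)) = Kdiag m n X x"
  show "compress T = X"
  proof (rule compress_eqI[OF X])
    fix w x assume w: "w \<in> words m" and x: "x \<in> R w"
    have n: "w \<in> nwords m (length w)" using w by (simp add: nwords_iff)
    have "U_adj m E U (length w) (T (emb w x)) w = Kdiag m (length w) X (single w x) w"
      using * single_in_Kspace[OF n x] by (simp add: emb_def)
    then show "coemb w (T (emb w x)) = X w x"
      using n by (simp add: U_adj_eq Kdiag_def single_def)
  qed
qed

lemma compress_inj: "inj_on compress (commutant_sa m P)"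
proof (rule inj_onI)
  fix S T assume S: "S \<in> commutant_sa m P" and T: "T \<in> commutant_sa m P"
    and eq: "compress S = compress T"
  have coemb_eq: "coemb w (S a) = coemb w (T a)" if a: "a \<in> level_space n" and w: "w \<in> nwords m n" for a n w
  proof -
    obtain x where "x \<in> Kspace m E n" "a = U n x" using a by (auto simp: level_space_eq)
    then have "U_adj m E U n (S a) = U_adj m E U n (T a)"
      using commutant_block_diagonal[OF S] commutant_block_diagonal[OF T] eq by simp
    then have "U_adj m E U n (S a) w = U_adj m E U n (T a) w" by simp
    then show ?thesis using w by (simp add: U_adj_eq)
  qed
  have same_n: "cinner (S a) b = cinner (T a) b" if a: "a \<in> level_space n" and b: "b \<in> level_space n" for a b n
  proof -
    have "cinner c b = (\<Sum>w\<in>nwords m n. cinner (coemb w c) (coemb w b))" for c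
      by (subst level_space_eq_sum_coemb[OF b], subst cinner.sum_right, intro sum.cong refl)
         (simp add: cinner_coemb coemb(1) nwords_iff)
    then show ?thesis using coemb_eq[OF a] by simp
  qed
  have dense: "cinner (S a) b = cinner (T a) b"
    if a: "a \<in> (\<Union>n. level_space n)" and b: "b \<in> (\<Union>n. level_space n)" for a b
  proof -
    obtain i j where "a \<in> level_space i" "b \<in> level_space j" using a b by auto
    then have "a \<in> level_space (max i j)" "b \<in> level_space (max i j)"
      using level_space_mono[of i "max i j"] level_space_mono[of j "max i j"] by auto
    then show ?thesis by (rule same_n)
  qed
  have on_D: "S b = T b" if b: "b \<in> (\<Union>n. level_space n)" for b
  proof -
    have "S b - T b = 0"
      using dense[OF b] by (intro cinner_eq_zero_dense[of "\<Union>n. level_space n"])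
        (auto simp: cinner.diff_left level_space_dense)
    then show ?thesis by simp
  qed
  show "S = T"
  proof
    fix x
    have "S x - T x = 0"
      using on_D by (intro cinner_eq_zero_dense[of "\<Union>n. level_space n"])
        (auto simp: cinner.diff_left level_space_dense commutantD(2)[OF S] commutantD(2)[OF T])
    then show "S x = T x" by simp
  qed
qed

section \<open>Reconstruction of the operator\<close>

lemma martingale_bound:
  assumes X: "bounded_range_martingale m E X"
  obtains c where "c \<ge> 0" "\<And>w x. w \<in> words m \<Longrightarrow> x \<in> R w \<Longrightarrow> norm (X w x) \<le> c * norm x"
proof -
  obtain c where c: "\<And>w. w \<in> words m \<Longrightarrow> onorm_on (R w) (X w) \<le> c"
    using X unfolding bounded_range_martingale_def bdd_above_def by blast
  have *: "norm (X w x) \<le> c * norm x" if w: "w \<in> words m" and x: "x \<in> R w" for w x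
  proof (cases "x = 0")
    case True
    then show ?thesis using bounded_clinear_on_zero[OF closed_csubspace_R[OF w] martingaleD(1)[OF X w]] by simp
  next
    case False
    obtain K where K: "K > 0" "\<And>x. x \<in> R w \<Longrightarrow> norm (X w x) \<le> K * norm x"
      using bounded_clinear_on_bound[OF martingaleD(1)[OF X w]] by auto
    have "norm (X w y) / norm y \<le> K" if "y \<in> R w" for y
      using K(2)[OF that] K(1) by (cases "y = 0") (simp_all add: divide_le_eq)
    then have "bdd_above ((\<lambda>x. norm (X w x) / norm x) ` R w)" by (auto intro!: bdd_aboveI2)
    then have "norm (X w x) / norm x \<le> onorm_on (R w) (X w)"
      unfolding onorm_on_def using x by (rule cSUP_upper2) simp
    then have "norm (X w x) / norm x \<le> c" using c[OF w] by (rule order_trans)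
    then show ?thesis using False by (simp add: divide_le_eq)
  qed
  show ?thesis
  proof (rule that[of "max c 0"])
    show "norm (X w x) \<le> max c 0 * norm x" if "w \<in> words m" "x \<in> R w" for w x
      using *[OF that] mult_right_mono[of c "max c 0" "norm x"] by simp
  qed simp
qed

text \<open>The operator on the dilation space with the blocks \<open>X w\<close>, \<open>w\<close> of length \<open>n\<close>, which vanishes on the
  orthogonal complement of the range of \<open>U n\<close>.\<close>

definition level_op :: "(nat list \<Rightarrow> 'h \<Rightarrow> 'h) \<Rightarrow> nat \<Rightarrow> 'k \<Rightarrow> 'k"
  where "level_op X n y = (\<Sum>w\<in>nwords m n. emb w (X w (coemb w y)))"

lemma level_op_cinner:
  assumes X: "bounded_range_martingale m E X"
  shows "cinner (level_op X n y) z = (\<Sum>w\<in>nwords m n. cinner (X w (coemb w y)) (coemb w z))"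
  unfolding level_op_def cinner.sum_left
  by (intro sum.cong refl) (simp add: nwords_iff coemb martingaleD(2)[OF X])

lemma level_op_selfadjoint:
  assumes X: "bounded_range_martingale m E X"
  shows "selfadjoint_on UNIV (level_op X n)"
  unfolding selfadjoint_on_UNIV_iff
proof (intro conjI allI)
  have "bounded_clinear_on UNIV (\<lambda>y. emb w (X w (coemb w y)))" if w: "w \<in> words m" for w
    by (rule bounded_clinear_on_compose[OF bounded_clinear_on_compose[OF coemb(3)[OF w] _
          martingaleD(1)[OF X w]] _ emb_clinear[OF w]])
       (simp_all add: coemb(1) w martingaleD(2)[OF X])
  then show "bounded_clinear_on UNIV (level_op X n)"
    unfolding level_op_def[abs_def] by (intro bounded_clinear_on_sum) (simp add: nwords_iff)
  fix x y
  have "cinner (level_op X n x) y = (\<Sum>w\<in>nwords m n. cinner (coemb w x) (X w (coemb w y)))"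
    unfolding level_op_cinner[OF X]
    by (intro sum.cong refl) (simp add: nwords_iff martingaleD(3)[OF X] coemb(1))
  also have "\<dots> = cnj (cinner (level_op X n y) x)"
    unfolding level_op_cinner[OF X] cnj_sum by (intro sum.cong refl) (rule cinner_commute)
  also have "\<dots> = cinner x (level_op X n y)" by (rule cinner_commute[symmetric])
  finally show "cinner (level_op X n x) y = cinner x (level_op X n y)" .
qed

lemma level_op_norm:
  assumes X: "bounded_range_martingale m E X" and c: "c \<ge> 0"
    and bound: "\<And>w x. w \<in> words m \<Longrightarrow> x \<in> R w \<Longrightarrow> norm (X w x) \<le> c * norm x"
  shows "norm (level_op X n y) \<le> c * norm y"
proof -
  have "(norm (level_op X n y))\<^sup>2 = (\<Sum>w\<in>nwords m n. (norm (X w (coemb w y)))\<^sup>2)"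
    unfolding level_op_def by (rule norm_sum_emb) (simp add: nwords_iff martingaleD(2)[OF X] coemb(1))
  also have "\<dots> \<le> (\<Sum>w\<in>nwords m n. c\<^sup>2 * (norm (coemb w y))\<^sup>2)"
    unfolding power_mult_distrib[symmetric]
    by (intro sum_mono power_mono bound) (auto simp: nwords_iff coemb(1))
  also have "\<dots> = c\<^sup>2 * (\<Sum>w\<in>nwords m n. (norm (coemb w y))\<^sup>2)" by (simp add: sum_distrib_left)
  also have "\<dots> \<le> c\<^sup>2 * (norm y)\<^sup>2" by (intro mult_left_mono bessel) simp
  finally have "(norm (level_op X n y))\<^sup>2 \<le> (c * norm y)\<^sup>2" by (simp add: power_mult_distrib)
  then show ?thesis by (rule power2_le_imp_le) (simp add: c)
qed

text \<open>On the range of \<open>U n\<close> the coordinates at length \<open>n + 1\<close> are the images of those at length \<open>n\<close> under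
  the edge contractions, so the martingale property identifies the two forms.\<close>

lemma level_op_Suc:
  assumes X: "bounded_range_martingale m E X" and a: "a \<in> level_space n" and b: "b \<in> level_space n"
  shows "cinner (level_op X (Suc n) a) b = cinner (level_op X n a) b"
  unfolding level_op_cinner[OF X] sum_nwords_Suc
proof (rule sum.cong[OF refl])
  fix w assume wn: "w \<in> nwords m n"
  then have w: "w \<in> words m" by (simp add: nwords_iff)
  have "cinner (X (w @ [j]) (coemb (w @ [j]) a)) (coemb (w @ [j]) b) =
      cinner (edge_adj m E w j (X (w @ [j]) (edge m E w j (coemb w a)))) (coemb w b)" if j: "j < m" for j
    unfolding coemb_append[OF a wn j] coemb_append[OF b wn j]
    using edge_adj(2)[OF w j coemb(1)[OF w]] by (metis cinner_commute)
  then show "(\<Sum>j<m. cinner (X (w @ [j]) (coemb (w @ [j]) a)) (coemb (w @ [j]) b)) =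
      cinner (X w (coemb w a)) (coemb w b)"
    by (simp add: martingaleD(4)[OF X w coemb(1)[OF w]] cinner.sum_left)
qed

lemma level_op_eventually_const:
  assumes X: "bounded_range_martingale m E X"
    and a: "a \<in> level_space n" and b: "b \<in> level_space n" and "n \<le> k"
  shows "cinner (level_op X k a) b = cinner (level_op X n a) b"
  using \<open>n \<le> k\<close>
proof (induction k rule: dec_induct)
  case (step k)
  then show ?case using level_op_Suc[OF X, of a k b] a b level_space_mono[of n k] by auto
qed simp

text \<open>The operator is the weak limit of the operators \<open>level_op X n\<close>.\<close>

lemma compress_surj:
  assumes X: "bounded_range_martingale m E X"
  shows "\<exists>T\<in>commutant_sa m P. compress T = X"
proof -
  obtain c where c: "c \<ge> 0" "\<And>w x. w \<in> words m \<Longrightarrow> x \<in> R w \<Longrightarrow> norm (X w x) \<le> c * norm x"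
    using martingale_bound[OF X] by blast
  have conv: "(\<lambda>k. cinner (level_op X k a) b) \<longlonglongrightarrow> cinner (level_op X n a) b"
    if "a \<in> level_space n" "b \<in> level_space n" for a b n
    by (rule tendsto_eventually, rule eventually_sequentiallyI[of n],
        rule level_op_eventually_const[OF X that])
  obtain T where T: "selfadjoint_on UNIV T"
    and lim: "\<And>x y. (\<lambda>n. cinner (level_op X n x) y) \<longlonglongrightarrow> cinner (T x) y"
  proof (rule weak_limit_selfadjoint[of "level_op X" c "\<Union>n. level_space n"])
    fix a b assume "a \<in> (\<Union>n. level_space n)" "b \<in> (\<Union>n. level_space n)"
    then obtain i j where "a \<in> level_space i" "b \<in> level_space j" by auto
    then have "a \<in> level_space (max i j)" "b \<in> level_space (max i j)"
      using level_space_mono[of i "max i j"] level_space_mono[of j "max i j"] by auto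
    then show "convergent (\<lambda>n. cinner (level_op X n a) b)"
      using conv unfolding convergent_def by blast
  qed (rule level_op_selfadjoint[OF X] level_op_norm[OF X c] level_space_dense that; assumption?)+
  have "T (P (cyl m w) x) = P (cyl m w) (T x)" if w: "w \<in> words m" for w x
  proof (rule csubspace_cinner_ext[OF closed_csubspace_UNIV UNIV_I UNIV_I])
    fix z
    \<comment> \<open>the two sides agree term by term: both vanish unless \<open>v\<close> extends \<open>w\<close>\<close>
    have "cinner (level_op X n (P (cyl m w) x)) z = cinner (level_op X n x) (P (cyl m w) z)"
      if n: "length w \<le> n" for n
      unfolding level_op_cinner[OF X]
    proof (rule sum.cong[OF refl])
      fix v assume "v \<in> nwords m n"
      then have v: "v \<in> words m" "length w \<le> length v" using n by (auto simp: nwords_iff)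
      have "X v 0 = 0" using bounded_clinear_on_zero[OF closed_csubspace_R[OF v(1)] martingaleD(1)[OF X v(1)]] .
      then show "cinner (X v (coemb v (P (cyl m w) x))) (coemb v z) =
          cinner (X v (coemb v x)) (coemb v (P (cyl m w) z))"
        by (simp add: coemb_P[OF w v] cinner.zero_left cinner.zero_right)
    qed
    then have "\<forall>\<^sub>F n in sequentially. cinner (level_op X n (P (cyl m w) x)) z =
        cinner (level_op X n x) (P (cyl m w) z)"
      by (auto simp: eventually_sequentially)
    then have "(\<lambda>n. cinner (level_op X n (P (cyl m w) x)) z) \<longlonglongrightarrow> cinner (T x) (P (cyl m w) z)"
      using lim[of x "P (cyl m w) z"] by (simp only: tendsto_cong)
    with lim have "cinner (T (P (cyl m w) x)) z = cinner (T x) (P (cyl m w) z)"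
      by (rule LIMSEQ_unique)
    then have "cinner (T (P (cyl m w) x)) z = cinner (P (cyl m w) (T x)) z"
      by (simp add: P_cinner[OF w])
    then show "cinner z (T (P (cyl m w) x)) = cinner z (P (cyl m w) (T x))"
      by (metis cinner_commute)
  qed
  then have "T (P B x) = P B (T x)" if "B \<in> sets (Omega m)" for B x
    using povm_commute_cyl[OF P_povm T _ that] by blast
  then have "T \<in> commutant_sa m P"
    using T by (auto simp: commutant_sa_def fun_eq_iff)
  moreover have "compress T = X"
  proof (rule compress_eqI[OF X])
    fix w x assume w: "w \<in> words m" and x: "x \<in> R w"
    have n: "w \<in> nwords m (length w)" using w by (simp add: nwords_iff)
    have co: "coemb v (emb w y) = (if v = w then y else 0)"
      if y: "y \<in> R w" and v: "v \<in> nwords m (length w)" for y v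
    proof (rule csubspace_cinner_ext[OF closed_csubspace_R])
      show v': "v \<in> words m" "coemb v (emb w y) \<in> R v" "(if v = w then y else 0) \<in> R v"
        using v y closed_csubspaceD(2)[OF closed_csubspace_R] by (auto simp: nwords_iff coemb(1))
      fix z assume z: "z \<in> R v"
      show "cinner z (coemb v (emb w y)) = cinner z (if v = w then y else 0)"
        using emb_cinner[OF v n z y] by (auto simp: coemb(2)[OF v'(1) z] cinner.zero_right)
    qed
    show "coemb w (T (emb w x)) = X w x"
    proof (rule csubspace_cinner_ext[OF closed_csubspace_R[OF w] coemb(1)[OF w] martingaleD(2)[OF X w x]])
      fix z assume z: "z \<in> R w"
      have "cinner (T (emb w x)) (emb w z) = cinner (level_op X (length w) (emb w x)) (emb w z)"
        using conv[OF emb_in_level_space[OF n x] emb_in_level_space[OF n z]] lim by (intro LIMSEQ_unique)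
      also have "\<dots> = (\<Sum>v\<in>nwords m (length w). if v = w then cinner (X w x) z else 0)"
        unfolding level_op_cinner[OF X]
        by (intro sum.cong refl) (auto simp: co[OF x] co[OF z] cinner.zero_right)
      also have "\<dots> = cinner (X w x) z" using n by (simp add: sum.delta')
      finally have "cinner (coemb w (T (emb w x))) z = cinner (X w x) z"
        by (simp add: cinner_coemb[OF w z])
      then show "cinner z (coemb w (T (emb w x))) = cinner z (X w x)" by (metis cinner_commute)
    qed
  qed
  ultimately show ?thesis by blast
qed

lemma compress_bij_betw: "bij_betw compress (commutant_sa m P) {X. bounded_range_martingale m E X}"
  unfolding bij_betw_def
proof (intro conjI compress_inj equalityI subsetI)
  fix X assume "X \<in> {X. bounded_range_martingale m E X}"
  then show "X \<in> compress ` commutant_sa m P" using compress_surj by blast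
qed (auto simp: compress_martingale)

end

theorem theorem4p4:
  fixes m :: nat
    and E :: "(nat \<Rightarrow> nat) set \<Rightarrow> 'h::chilbert_space \<Rightarrow> 'h"
    and U :: "nat \<Rightarrow> (nat list \<Rightarrow> 'h) \<Rightarrow> 'k::chilbert_space"
    and P :: "(nat \<Rightarrow> nat) set \<Rightarrow> 'k \<Rightarrow> 'k"
    and V :: "'h \<Rightarrow> 'k"
  assumes "m \<ge> 2"
    and "povm m E"
    and "range_space_dilation m E U P V"
  shows "\<exists>\<Phi>. bij_betw \<Phi> (commutant_sa m P) {X. bounded_range_martingale m E X} \<and>
    (\<forall>T\<in>commutant_sa m P. \<forall>X. bounded_range_martingale m E X \<longrightarrow>
      (\<Phi> T = X \<longleftrightarrow> (\<forall>n. \<forall>x\<in>Kspace m E n. U_adj m E U n (T (U n x)) = Kdiag m n X x)))"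
proof -
  interpret range_dilation m E U P
    using assms(2,3) by unfold_locales (auto simp: range_space_dilation_def)
  show ?thesis
    using compress_bij_betw compress_eq_iff by blast
qed

end
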